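(* Let $G$ be a bipartite graph with vertex set $V(G)=\{x_1,\dots,x_n\}$, let $\mathbb{K}$ be a field, let $S=\mathbb{K}[x_1,\dots,x_n]$, and let $J(G)\subseteq S$ be the cover ideal of $G$. Then there exists an integer $n_0\geq 1$ such that for every integer $k\geq n_0$, both $J(G)^k$ and $S/J(G)^k$ satisfy Stanley's inequality, i.e. $$\mathrm{depth}(J(G)^k)\leq \mathrm{sdepth}(J(G)^k)\quad\text{and}\quad \mathrm{depth}(S/J(G)^k)\leq \mathrm{sdepth}(S/J(G)^k).$$
   Context: Graphs are finite and simple; the vertices of $G$ are identified with the variables of $S$. A graph is bipartite if its vertex set is partitioned into two disjoint (not necessarily nonempty) subsets such that the two endpoints of each edge lie in distinct parts. Cover ideal: $J(G)=\bigcap_{\{x_i,x_j\}\in E(G)}(x_i,x_j)\subseteq S$ (so $J(G)=S$ if $G$ has no edges). $J(G)^k$ denotes the ordinary $k$-th power. Stanley depth: let $M$ be a finitely generated $\mathbb{Z}^n$-graded $S$-module. For a homogeneous element $u\in M$ and $Z\subseteq\{x_1,\dots,x_n\}$, the $\mathbb{K}$-subspace $u\mathbb{K}[Z]$ generated by all $uv$ with $v\in\mathbb{K}[Z]$ is called a Stanley space of dimension $|Z|$ if it is a free $\mathbb{K}[Z]$-module. A Stanley decomposition $\mathcal{D}$ of $M$ is a decomposition of $M$ as a finite direct sum (of $\mathbb{K}$-vector spaces) of Stanley spaces; $\mathrm{sdepth}(\mathcal{D})$ is the minimum dimension of a Stanley space in $\mathcal{D}$; and $\mathrm{sdepth}(M)$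 is the maximum of $\mathrm{sdepth}(\mathcal{D})$ over all Stanley decompositions $\mathcal{D}$ of $M$. Depth is with respect to the ideal $(x_1,\dots,x_n)$. The depth and Stanley depth of the zero module are $+\infty$ by convention. *)

theory Defs
  imports
    "HOL-Algebra.Module"
    "HOL-Algebra.QuotRing"
    "HOL-Algebra.Ideal_Product"
    "HOL-Library.Poly_Mapping"
    "HOL-Library.Extended_Nat"
begin

section \<open>Graphs\<close>

definition simple_graph :: "'v set \<Rightarrow> 'v set set \<Rightarrow> bool" where
  "simple_graph V E \<longleftrightarrow> finite V \<and> (\<forall>e\<in>E. e \<subseteq> V \<and> card e = 2)"

definition bipartite :: "'v set \<Rightarrow> 'v set set \<Rightarrow> bool" where
  "bipartite V E \<longleftrightarrow>
    (\<exists>A B. A \<union> B = V \<and> A \<inter> B = {} \<and> (\<forall>e\<in>E. \<exists>a\<in>A. \<exists>b\<in>B. e = {a, b}))"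


section \<open>Polynomial rings\<close>

text \<open>A monomial is its finitely supported exponent vector; a polynomial is a finitely supported
  family of coefficients indexed by monomials, with the convolution product of
  \<^theory>\<open>HOL-Library.Poly_Mapping\<close>. The variables range over the whole type \<^typ>\<open>'v\<close>;
  \<open>mpoly_ring V\<close> is \<open>K[x\<^sub>i | i \<in> V]\<close>, the subring of polynomials
  that involve only variables from \<open>V\<close>.\<close>

type_synonym ('v, 'k) mpoly = "('v \<Rightarrow>\<^sub>0 nat) \<Rightarrow>\<^sub>0 'k"

definition mpoly_ring :: "'v set \<Rightarrow> ('v, 'k::field) mpoly ring" where
  "mpoly_ring V =
    \<lparr>carrier = {p. \<forall>t\<in>Poly_Mapping.keys p. Poly_Mapping.keys t \<subseteq> V},
     mult = (*), one = 1, zero = 0, add = (+)\<rparr>"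

definition var :: "'v \<Rightarrow> ('v, 'k::field) mpoly" where
  "var i = Poly_Mapping.single (Poly_Mapping.single i 1) 1"

definition max_homogeneous_ideal :: "'v set \<Rightarrow> ('v, 'k::field) mpoly set" where
  "max_homogeneous_ideal V = Idl\<^bsub>mpoly_ring V\<^esub> (var ` V)"

text \<open>The intersection with the carrier only matters if there are no edges: it makes the empty
  intersection the whole ring.\<close>

definition cover_ideal :: "'v set \<Rightarrow> 'v set set \<Rightarrow> ('v, 'k::field) mpoly set" where
  "cover_ideal V E = carrier (mpoly_ring V) \<inter> (\<Inter>e\<in>E. Idl\<^bsub>mpoly_ring V\<^esub> (var ` e))"

text \<open>The component of multidegree \<open>a\<close>, where only the values of \<open>a\<close> on
  \<open>V\<close> matter. It is zero if \<open>a\<close> has a negative entry.\<close>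

definition mpoly_component :: "'v set \<Rightarrow> ('v \<Rightarrow> int) \<Rightarrow> ('v, 'k::field) mpoly set" where
  "mpoly_component V a =
    {p \<in> carrier (mpoly_ring V).
      \<forall>t\<in>Poly_Mapping.keys p. \<forall>i\<in>V. int (Poly_Mapping.lookup t i) = a i}"


section \<open>Ideals and quotient rings as modules\<close>

text \<open>The record type of modules extends that of rings, so the fields \<^const>\<open>mult\<close> and
  \<^const>\<open>one\<close> have to be filled, but they play no role in the module structure.\<close>

definition ideal_module :: "'a ring \<Rightarrow> 'a set \<Rightarrow> ('a, 'a) module" where
  "ideal_module R I =
    \<lparr>carrier = I, mult = mult R, one = one R, zero = zero R, add = add R, smult = mult R\<rparr>"

definition quotient_module :: "'a ring \<Rightarrow> 'a set \<Rightarrow> ('a, 'a set) module" where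
  "quotient_module R I =
    \<lparr>carrier = carrier (R Quot I), mult = mult (R Quot I), one = one (R Quot I),
     zero = zero (R Quot I), add = add (R Quot I),
     smult = (\<lambda>r X. (I +>\<^bsub>R\<^esub> r) \<otimes>\<^bsub>R Quot I\<^esub> X)\<rparr>"

definition ideal_component ::
    "'v set \<Rightarrow> ('v, 'k::field) mpoly set \<Rightarrow> ('v \<Rightarrow> int) \<Rightarrow> ('v, 'k) mpoly set" where
  "ideal_component V I a = I \<inter> mpoly_component V a"

definition quotient_component ::
    "'v set \<Rightarrow> ('v, 'k::field) mpoly set \<Rightarrow> ('v \<Rightarrow> int) \<Rightarrow> ('v, 'k) mpoly set set" where
  "quotient_component V I a = (\<lambda>p. I +>\<^bsub>mpoly_ring V\<^esub> p) ` mpoly_component V a"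


section \<open>Depth\<close>

text \<open>The submodule \<open>(f\<^sub>1, \<dots>, f\<^sub>r) M\<close>.\<close>

definition seq_submodule :: "('a, 'm) module \<Rightarrow> 'a list \<Rightarrow> 'm set" where
  "seq_submodule M fs =
    {\<Oplus>\<^bsub>M\<^esub>i\<in>{..<length fs}. (fs ! i) \<odot>\<^bsub>M\<^esub> g i | g. g \<in> {..<length fs} \<rightarrow> carrier M}"

text \<open>Each \<open>f\<^sub>i\<close> is a nonzerodivisor on \<open>M / (f\<^sub>1, \<dots>, f\<^bsub>i-1\<^esub>) M\<close>, and
  \<open>M / (f\<^sub>1, \<dots>, f\<^sub>r) M\<close> is nonzero.\<close>

definition regular_sequence :: "('a, 'm) module \<Rightarrow> 'a list \<Rightarrow> bool" where
  "regular_sequence M fs \<longleftrightarrow>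
    (\<forall>i<length fs. \<forall>m\<in>carrier M.
      (fs ! i) \<odot>\<^bsub>M\<^esub> m \<in> seq_submodule M (take i fs) \<longrightarrow> m \<in> seq_submodule M (take i fs)) \<and>
    seq_submodule M fs \<noteq> carrier M"

definition depth :: "'a set \<Rightarrow> ('a, 'm) module \<Rightarrow> enat" where
  "depth I M =
    (if carrier M = {\<zero>\<^bsub>M\<^esub>} then \<infinity>
     else Sup {enat (length fs) | fs. set fs \<subseteq> I \<and> regular_sequence M fs})"


section \<open>Stanley depth\<close>

text \<open>Freeness is the existence of a basis: a set such that every element of the module is a
  linear combination of its elements, with finitely many nonzero coefficients, in exactly one
  way.\<close>

definition free_module :: "'a ring \<Rightarrow> ('a, 'm) module \<Rightarrow> bool" where
  "free_module R M \<longleftrightarrow>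
    (\<exists>B\<subseteq>carrier M. \<forall>m\<in>carrier M. \<exists>!c.
      c \<in> B \<rightarrow>\<^sub>E carrier R \<and> finite {b\<in>B. c b \<noteq> \<zero>\<^bsub>R\<^esub>} \<and>
      m = (\<Oplus>\<^bsub>M\<^esub>b\<in>{b\<in>B. c b \<noteq> \<zero>\<^bsub>R\<^esub>}. c b \<odot>\<^bsub>M\<^esub> b))"

text \<open>The subspace \<open>u K[Z]\<close>.\<close>

definition stanley_subspace ::
    "(('v, 'k::field) mpoly, 'm) module \<Rightarrow> 'm \<Rightarrow> 'v set \<Rightarrow> 'm set" where
  "stanley_subspace M u Z = {v \<odot>\<^bsub>M\<^esub> u | v. v \<in> carrier (mpoly_ring Z)}"

text \<open>A multigraded module over \<open>mpoly_ring V\<close> is passed as a module \<open>M\<close> together with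
  the family \<open>gr\<close> of its graded components.\<close>

definition stanley_space ::
    "'v set \<Rightarrow> (('v \<Rightarrow> int) \<Rightarrow> 'm set) \<Rightarrow> (('v, 'k::field) mpoly, 'm) module \<Rightarrow> 'm \<Rightarrow> 'v set \<Rightarrow> bool"
  where
  "stanley_space V gr M u Z \<longleftrightarrow>
    u \<in> carrier M \<and> (\<exists>a. u \<in> gr a) \<and> Z \<subseteq> V \<and>
    free_module (mpoly_ring Z) (M\<lparr>carrier := stanley_subspace M u Z\<rparr>)"

text \<open>The last conjunct says that \<open>M\<close> is the internal direct sum of the spaces
  \<open>u K[Z]\<close>. The degenerate spaces with \<open>u = 0\<close> are not excluded; dropping them from a
  decomposition never decreases its Stanley depth. The empty decomposition of the zero module
  has Stanley depth \<open>\<infinity>\<close>.\<close>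

definition stanley_decomposition ::
    "'v set \<Rightarrow> (('v \<Rightarrow> int) \<Rightarrow> 'm set) \<Rightarrow> (('v, 'k::field) mpoly, 'm) module \<Rightarrow> ('m \<times> 'v set) set \<Rightarrow> bool"
  where
  "stanley_decomposition V gr M D \<longleftrightarrow>
    finite D \<and> (\<forall>(u, Z)\<in>D. stanley_space V gr M u Z) \<and>
    (\<forall>m\<in>carrier M. \<exists>!f.
      f \<in> (\<Pi>\<^sub>E (u, Z)\<in>D. stanley_subspace M u Z) \<and> m = (\<Oplus>\<^bsub>M\<^esub>d\<in>D. f d))"

definition decomposition_sdepth :: "('m \<times> 'v set) set \<Rightarrow> enat" where
  "decomposition_sdepth D = (INF (u, Z)\<in>D. enat (card Z))"

definition sdepth ::
    "'v set \<Rightarrow> (('v \<Rightarrow> int) \<Rightarrow> 'm set) \<Rightarrow> (('v, 'k::field) mpoly, 'm) module \<Rightarrow> enat" where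
  "sdepth V gr M = Sup {decomposition_sdepth D | D. stanley_decomposition V gr M D}"

end

(*
The depth is governed by ordered matchings: let s be the largest size of a matching (p_i, q_i) in G
with p_i in one part, q_i in the other, and p_i not adjacent to q_j for i < j.

As G is bipartite, J^k is spanned by the monomials x^b with b_i + b_j >= k for all edges. Splitting
such exponents repeatedly at the first vertex of one part with minimal exponent partitions J^k and
its complement into boxes; the vertices split off form an ordered matching, so every box has
dimension at least n - s, respectively n - s - 1.

Conversely, for k >= s an ordered matching of size s yields exponents b such that precisely the
matching edges have b_i + b_j < k. With N = k + 1, the cross-polytope cycle on the matching vertices
then gives a nonzero class in degree s, respectively s + 1, of the Koszul homology of the powers x_i^N
with coefficients in J^k, respectively S / J^k. Each element of a regular sequence in the maximal
ideal raises the degree of a nonzero class by one, so regular sequences have length at most n - s,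
respectively n - s - 1.
*)

theory Submission
  imports Defs
begin

section \<open>Koszul complexes\<close>

text \<open>\<open>depth\<close> is a supremum over all regular sequences in the maximal ideal,
  homogeneous or not, so the depth bound cannot use a grading on the sequence. Instead, some power
  of each such f lies in the ideal of the \<open>x_i^N\<close>, which annihilates Koszul homology:
  the last multiple \<open>f^l z\<close> of a nonzero class that is still nonzero is killed by f,
  and lifts through the connecting map to a class one degree higher modulo f. Powers of the
  variables are used because a vertex outside the matching gets exponent k, which satisfies all its
  edges, but must not be available as a direction for a chain of the next degree; for N > k,
  \<open>x_i^N\<close> does not divide \<open>x_i^k\<close>. The i-th matching edge gets exponents
  with sum k - 1, staggered along the order of the matching so that all other edges hold; k >= s
  keeps them nonnegative. The class for S / J^k is a preimage of the cycle under the connecting map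
  to the homology of J^k, whence the additional degree. It needs a matching edge; without edges the
  quotient is zero and both invariants are infinite.\<close>

definition koszul_sign :: "'i::linorder \<Rightarrow> 'i set \<Rightarrow> 'a::comm_ring_1" where
  "koszul_sign i \<sigma> = (-1) ^ card {j \<in> \<sigma>. j < i}"

lemma koszul_sign_square [simp]: "koszul_sign i \<sigma> * koszul_sign i \<sigma> = (1 :: 'a::comm_ring_1)"
  by (simp add: koszul_sign_def flip: power_mult_distrib)

text \<open>Only elements strictly below \<open>i\<close> are counted. Hence one sign serves both
  for inserting e_i into an exterior monomial and for removing it.\<close>

lemma koszul_sign_remove [simp]: "koszul_sign i (\<sigma> - {i}) = koszul_sign i \<sigma>"
proof -
  have "{j \<in> \<sigma> - {i}. j < i} = {j \<in> \<sigma>. j < i}" by auto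
  then show ?thesis by (simp add: koszul_sign_def)
qed

lemma koszul_sign_insert:
  assumes "finite \<sigma>" "j \<notin> \<sigma>"
  shows "koszul_sign i (insert j \<sigma>) = (if j < i then - koszul_sign i \<sigma> else koszul_sign i \<sigma>)"
proof -
  have "{k \<in> insert j \<sigma>. k < i} = (if j < i then insert j {k \<in> \<sigma>. k < i} else {k \<in> \<sigma>. k < i})"
    by auto
  with assms show ?thesis by (simp add: koszul_sign_def)
qed

lemma koszul_sign_swap:
  assumes "finite \<sigma>" "i \<notin> \<sigma>" "j \<notin> \<sigma>" "i \<noteq> j"
  shows "koszul_sign j (insert i \<sigma>) * koszul_sign i \<sigma>
    = - (koszul_sign i (insert j \<sigma>) * (koszul_sign j \<sigma> :: 'a::comm_ring_1))"
  using assms by (auto simp: koszul_sign_insert mult.commute)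

lemma koszul_sign_cases: "(koszul_sign i \<sigma> :: 'a::comm_ring_1) \<in> {1, -1}"
  by (simp add: koszul_sign_def minus_one_power_iff)

text \<open>Pairs with \<open>i < j\<close> cancel against their mirror images. The diagonal is left
  out because antisymmetry does not make it vanish in characteristic 2.\<close>

lemma sum_antisymmetric:
  fixes F :: "'i::linorder \<Rightarrow> 'i \<Rightarrow> 'a::ab_group_add"
  assumes "finite A" and F: "\<And>i j. i \<in> A \<Longrightarrow> j \<in> A \<Longrightarrow> i \<noteq> j \<Longrightarrow> F i j = - F j i"
  shows "(\<Sum>i\<in>A. \<Sum>j\<in>A - {i}. F i j) = 0"
proof -
  let ?P = "{(i, j) \<in> A \<times> A. i < j}"
  have fin: "finite ?P" by (rule finite_subset[of _ "A \<times> A"]) (use assms in auto)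
  have "(\<Sum>i\<in>A. \<Sum>j\<in>A - {i}. F i j) = (\<Sum>(i, j)\<in>Sigma A (\<lambda>i. A - {i}). F i j)"
    using \<open>finite A\<close> by (simp add: sum.Sigma)
  also have "Sigma A (\<lambda>i. A - {i}) = ?P \<union> prod.swap ` ?P"
    by (auto simp: image_iff)
  also have "(\<Sum>(i, j)\<in>?P \<union> prod.swap ` ?P. F i j)
      = (\<Sum>(i, j)\<in>?P. F i j) + (\<Sum>(i, j)\<in>prod.swap ` ?P. F i j)"
    by (rule sum.union_disjoint) (use fin in auto)
  also have "(\<Sum>(i, j)\<in>prod.swap ` ?P. F i j) = (\<Sum>(i, j)\<in>?P. F j i)"
    by (subst sum.reindex) (auto simp: case_prod_unfold)
  also have "\<dots> = (\<Sum>(i, j)\<in>?P. - F i j)"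
  proof (rule sum.cong[OF refl], clarify)
    fix i j assume "i \<in> A" "j \<in> A" "i < j"
    then show "F j i = - F i j" using F[of j i] by blast
  qed
  finally show ?thesis by (simp add: sum_negf case_prod_unfold)
qed

text \<open>\<open>R\<close> is a subring inside the type \<open>'a\<close>: the polynomial type has
  a variable for every element of \<open>'v\<close>, so K[x_i | i \<in> V] is only a subset of
  it.\<close>

locale koszul =
  fixes V :: "'i::linorder set" and y :: "'i \<Rightarrow> 'a::comm_ring_1" and R :: "'a set"
  assumes finite_V: "finite V"
    and y_R: "i \<in> V \<Longrightarrow> y i \<in> R"
    and zero_R: "0 \<in> R" and one_R: "1 \<in> R"
    and add_R: "a \<in> R \<Longrightarrow> b \<in> R \<Longrightarrow> a + b \<in> R"
    and mult_R: "a \<in> R \<Longrightarrow> b \<in> R \<Longrightarrow> a * b \<in> R"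
    and uminus_R: "a \<in> R \<Longrightarrow> - a \<in> R"
begin

text \<open>The Koszul differential read off in coefficients: \<open>z \<sigma>\<close> is the
  coefficient of the exterior monomial e_\<sigma>, and e_\<sigma> receives one contribution from
  each exterior monomial with one more factor.\<close>

definition bd :: "('i set \<Rightarrow> 'a) \<Rightarrow> 'i set \<Rightarrow> 'a" where
  "bd z \<sigma> = (\<Sum>i\<in>V - \<sigma>. koszul_sign i \<sigma> * y i * z (insert i \<sigma>))"

text \<open>Exterior multiplication by e_i from the left.\<close>

definition wedge :: "'i \<Rightarrow> ('i set \<Rightarrow> 'a) \<Rightarrow> 'i set \<Rightarrow> 'a" where
  "wedge i z \<sigma> = (if i \<in> \<sigma> then koszul_sign i \<sigma> * z (\<sigma> - {i}) else 0)"

text \<open>The Leibniz rule. It makes \<open>wedge i\<close> a homotopy between multiplication by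
  \<open>y i\<close> and zero.\<close>

lemma bd_wedge:
  assumes i: "i \<in> V" and fin: "finite \<sigma>"
  shows "bd (wedge i z) \<sigma> = y i * z \<sigma> - wedge i (bd z) \<sigma>"
proof (cases "i \<in> \<sigma>")
  case False
  then have "bd (wedge i z) \<sigma> = (\<Sum>j\<in>V - \<sigma>. if j = i then y i * z \<sigma> else 0)"
    unfolding bd_def by (intro sum.cong)
      (use fin in \<open>auto simp: wedge_def koszul_sign_insert algebra_simps\<close>)
  with False i finite_V show ?thesis by (simp add: wedge_def)
next
  \<comment> \<open>On the left there is no term with \<open>j = i\<close>. On the right the term
    \<open>y i * z \<sigma>\<close> cancels against the summand of \<open>wedge i (bd z)\<close>
    that reinserts \<open>i\<close>; the remaining summands agree up to sign.\<close>
  case True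
  let ?\<tau> = "\<sigma> - {i}"
  have "V - ?\<tau> = insert i (V - \<sigma>)" using i True by auto
  then have "bd z ?\<tau> = koszul_sign i ?\<tau> * y i * z \<sigma>
      + (\<Sum>j\<in>V - \<sigma>. koszul_sign j ?\<tau> * y j * z (insert j ?\<tau>))"
    using True finite_V unfolding bd_def by (simp add: insert_absorb)
  then have "wedge i (bd z) \<sigma> = y i * z \<sigma>
      + (\<Sum>j\<in>V - \<sigma>. koszul_sign i \<sigma> * koszul_sign j ?\<tau> * y j * z (insert j ?\<tau>))"
    using True by (simp add: wedge_def algebra_simps sum_distrib_left)
  moreover have "bd (wedge i z) \<sigma>
      = - (\<Sum>j\<in>V - \<sigma>. koszul_sign i \<sigma> * koszul_sign j ?\<tau> * y j * z (insert j ?\<tau>))"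
    unfolding bd_def sum_negf[symmetric]
  proof (rule sum.cong[OF refl])
    fix j assume "j \<in> V - \<sigma>"
    then have j: "j \<notin> ?\<tau>" "j \<noteq> i" "j \<notin> \<sigma>" using True by auto
    \<comment> \<open>Exactly one of \<open>i < j\<close> and \<open>j < i\<close> holds, so exactly
      one of the two signs flips.\<close>
    have swap: "(if i < j then - a else a) * (if j < i then - b else b) = - (b * a)" for a b :: 'a
      using j(2) by (auto simp: mult.commute)
    have "koszul_sign j \<sigma> = (if i < j then - koszul_sign j ?\<tau> else (koszul_sign j ?\<tau> :: 'a))"
      using koszul_sign_insert[of ?\<tau> i j] fin by (simp add: insert_absorb[OF True])
    moreover have "koszul_sign i (insert j \<sigma>) = (if j < i then - koszul_sign i \<sigma> else (koszul_sign i \<sigma> :: 'a))"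
      using koszul_sign_insert[of \<sigma> j i] fin j by simp
    ultimately have "koszul_sign j \<sigma> * koszul_sign i (insert j \<sigma>) =
        (if i < j then - koszul_sign j ?\<tau> else koszul_sign j ?\<tau>) *
        (if j < i then - koszul_sign i \<sigma> else (koszul_sign i \<sigma> :: 'a))"
      by (rule arg_cong2)
    then have sign: "koszul_sign j \<sigma> * koszul_sign i (insert j \<sigma>) = - (koszul_sign i \<sigma> * (koszul_sign j ?\<tau> :: 'a))"
      unfolding swap .
    have "insert j \<sigma> - {i} = insert j ?\<tau>" using j by auto
    then have "koszul_sign j \<sigma> * y j * wedge i z (insert j \<sigma>)
        = (koszul_sign j \<sigma> * koszul_sign i (insert j \<sigma>)) * (y j * z (insert j ?\<tau>))"
      using True by (simp add: wedge_def mult.assoc mult.left_commute)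
    then show "koszul_sign j \<sigma> * y j * wedge i z (insert j \<sigma>)
        = - (koszul_sign i \<sigma> * koszul_sign j ?\<tau> * y j * z (insert j ?\<tau>))"
      unfolding sign by (simp add: mult.assoc)
  qed
  ultimately show ?thesis by (simp add: algebra_simps)
qed

lemma bd_bd:
  assumes "finite \<sigma>"
  shows "bd (bd z) \<sigma> = 0"
proof -
  have "bd (bd z) \<sigma> = (\<Sum>i\<in>V - \<sigma>. \<Sum>j\<in>(V - \<sigma>) - {i}.
      koszul_sign j (insert i \<sigma>) * koszul_sign i \<sigma> * (y i * y j * z (insert i (insert j \<sigma>))))"
    unfolding bd_def
    by (auto simp: sum_distrib_left insert_commute algebra_simps intro!: sum.cong)
  also have "\<dots> = 0"
  proof (rule sum_antisymmetric)
    fix i j assume "i \<in> V - \<sigma>" "j \<in> V - \<sigma>" "i \<noteq> j"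
    then have "koszul_sign j (insert i \<sigma>) * koszul_sign i \<sigma>
        = - (koszul_sign i (insert j \<sigma>) * (koszul_sign j \<sigma> :: 'a))"
      using koszul_sign_swap assms by blast
    then show "koszul_sign j (insert i \<sigma>) * koszul_sign i \<sigma> * (y i * y j * z (insert i (insert j \<sigma>)))
      = - (koszul_sign i (insert j \<sigma>) * koszul_sign j \<sigma> * (y j * y i * z (insert j (insert i \<sigma>))))"
      by (simp add: insert_commute mult.commute)
  qed (use finite_V in auto)
  finally show ?thesis .
qed

lemma bd_add: "bd (\<lambda>\<sigma>. z \<sigma> + w \<sigma>) \<sigma> = bd z \<sigma> + bd w \<sigma>"
  by (simp add: bd_def algebra_simps sum.distrib)

lemma bd_diff: "bd (\<lambda>\<sigma>. z \<sigma> - w \<sigma>) \<sigma> = bd z \<sigma> - bd w \<sigma>"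
  by (simp add: bd_def algebra_simps sum_subtractf)

lemma bd_scale: "bd (\<lambda>\<sigma>. c * z \<sigma>) \<sigma> = c * bd z \<sigma>"
  by (simp add: bd_def algebra_simps sum_distrib_left)

lemma bd_sum: "bd (\<lambda>\<sigma>. \<Sum>i\<in>A. z i \<sigma>) \<sigma> = (\<Sum>i\<in>A. bd (z i) \<sigma>)"
  unfolding bd_def sum_distrib_left by (rule sum.swap)

section \<open>Koszul homology with coefficients in a quotient of submodules\<close>

definition submod :: "'a set \<Rightarrow> bool" where
  "submod M \<longleftrightarrow> 0 \<in> M \<and> (\<forall>a\<in>M. \<forall>b\<in>M. a + b \<in> M) \<and> (\<forall>r\<in>R. \<forall>a\<in>M. r * a \<in> M)"

lemma submod_0: "submod M \<Longrightarrow> 0 \<in> M"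
  and submod_add: "submod M \<Longrightarrow> a \<in> M \<Longrightarrow> b \<in> M \<Longrightarrow> a + b \<in> M"
  and submod_mult: "submod M \<Longrightarrow> r \<in> R \<Longrightarrow> a \<in> M \<Longrightarrow> r * a \<in> M"
  by (auto simp: submod_def)

lemma submod_uminus: "submod M \<Longrightarrow> a \<in> M \<Longrightarrow> - a \<in> M"
  using submod_mult[of M "-1" a] uminus_R one_R by simp

lemma submod_diff: "submod M \<Longrightarrow> a \<in> M \<Longrightarrow> b \<in> M \<Longrightarrow> a - b \<in> M"
  using submod_add[of M a "- b"] submod_uminus by simp

lemma submod_sum: "submod M \<Longrightarrow> (\<And>i. i \<in> A \<Longrightarrow> h i \<in> M) \<Longrightarrow> sum h A \<in> M"
  by (induction A rule: infinite_finite_induct) (auto simp: submod_0 submod_add)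

lemma koszul_sign_R: "koszul_sign i \<sigma> \<in> R"
proof -
  have "koszul_sign i \<sigma> \<in> {1, -1 :: 'a}" by (rule koszul_sign_cases)
  then show ?thesis using one_R uminus_R by auto
qed

lemma power_R: "f \<in> R \<Longrightarrow> f ^ l \<in> R"
  by (induction l) (auto simp: one_R mult_R)

lemma bd_mem: "submod M \<Longrightarrow> (\<And>\<sigma>. z \<sigma> \<in> M) \<Longrightarrow> bd z \<sigma> \<in> M"
  unfolding bd_def by (auto intro!: submod_sum submod_mult[of M] mult_R koszul_sign_R y_R)

lemma wedge_mem: "submod M \<Longrightarrow> (\<And>\<sigma>. z \<sigma> \<in> M) \<Longrightarrow> wedge i z \<sigma> \<in> M"
  unfolding wedge_def by (auto intro!: submod_mult submod_0 koszul_sign_R)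

definition chain :: "'a set \<Rightarrow> nat \<Rightarrow> ('i set \<Rightarrow> 'a) \<Rightarrow> bool" where
  "chain M j z \<longleftrightarrow> (\<forall>\<sigma>. z \<sigma> \<in> M) \<and> (\<forall>\<sigma>. \<sigma> \<subseteq> V \<and> card \<sigma> = j \<or> z \<sigma> = 0)"

lemma chain_outside: "chain M j z \<Longrightarrow> \<not> (\<sigma> \<subseteq> V \<and> card \<sigma> = j) \<Longrightarrow> z \<sigma> = 0"
  by (auto simp: chain_def)

text \<open>Settles the sets not contained in \<open>V\<close>, which may be infinite and are then
  out of reach of \<open>bd_wedge\<close> and \<open>bd_bd\<close>.\<close>

lemma chain_bd_outside:
  assumes "chain M j z" "\<not> (\<sigma> \<subseteq> V \<and> Suc (card \<sigma>) = j)"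
  shows "bd z \<sigma> = 0"
  unfolding bd_def
proof (intro sum.neutral ballI)
  fix i assume i: "i \<in> V - \<sigma>"
  have "\<not> (insert i \<sigma> \<subseteq> V \<and> card (insert i \<sigma>) = j)"
    using i assms(2) finite_V finite_subset[of \<sigma> V] by auto
  then have "z (insert i \<sigma>) = 0" using assms(1) chain_outside by blast
  then show "koszul_sign i \<sigma> * y i * z (insert i \<sigma>) = 0" by simp
qed

lemma chain_wedge:
  assumes "submod M" "chain M j z" "i \<in> V"
  shows "chain M (Suc j) (wedge i z)"
  unfolding chain_def
proof (intro conjI allI)
  show "wedge i z \<sigma> \<in> M" for \<sigma> using wedge_mem[OF assms(1)] assms(2) by (auto simp: chain_def)
  fix \<sigma>
  have "z (\<sigma> - {i}) = 0" if "i \<in> \<sigma>" "\<not> (\<sigma> \<subseteq> V \<and> card \<sigma> = Suc j)"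
  proof -
    have "\<not> (\<sigma> - {i} \<subseteq> V \<and> card (\<sigma> - {i}) = j)"
      using that assms(3) finite_V finite_subset[of "\<sigma> - {i}" V] card_Suc_Diff1[of \<sigma> i] by auto
    then show ?thesis using assms(2) chain_outside by blast
  qed
  then show "\<sigma> \<subseteq> V \<and> card \<sigma> = Suc j \<or> wedge i z \<sigma> = 0"
    by (cases "\<sigma> \<subseteq> V \<and> card \<sigma> = Suc j") (auto simp: wedge_def)
qed

lemma chain_scale: "submod M \<Longrightarrow> r \<in> R \<Longrightarrow> chain M j z \<Longrightarrow> chain M j (\<lambda>\<sigma>. r * z \<sigma>)"
  by (auto simp: chain_def submod_mult)

lemma chain_sum:
  "submod M \<Longrightarrow> (\<And>i. i \<in> A \<Longrightarrow> chain M j (z i)) \<Longrightarrow> chain M j (\<lambda>\<sigma>. \<Sum>i\<in>A. z i \<sigma>)"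
  by (auto simp: chain_def intro!: submod_sum sum.neutral)

definition boundary :: "'a set \<Rightarrow> 'a set \<Rightarrow> nat \<Rightarrow> ('i set \<Rightarrow> 'a) \<Rightarrow> bool" where
  "boundary M N j z \<longleftrightarrow> (\<exists>w. chain M (Suc j) w \<and> (\<forall>\<sigma>. z \<sigma> - bd w \<sigma> \<in> N))"

text \<open>A representative of a nonzero element of the Koszul homology \<open>H\<^sub>j(y; M / N)\<close>.\<close>

definition koszul_class :: "'a set \<Rightarrow> 'a set \<Rightarrow> nat \<Rightarrow> ('i set \<Rightarrow> 'a) \<Rightarrow> bool" where
  "koszul_class M N j z \<longleftrightarrow> chain M j z \<and> (\<forall>\<sigma>. bd z \<sigma> \<in> N) \<and> \<not> boundary M N j z"

text \<open>The ideal generated by the \<open>y i\<close> annihilates Koszul homology: the homotopy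
  is the combination of the \<open>wedge i\<close> with coefficients \<open>g i\<close>, and its
  error term involves only \<open>bd z\<close>, which lies in \<open>N\<close>.\<close>

lemma boundary_scale:
  assumes M: "submod M" and N: "submod N"
    and z: "chain M j z" "\<And>\<sigma>. bd z \<sigma> \<in> N"
    and g: "\<And>i. i \<in> V \<Longrightarrow> g i \<in> R"
  shows "boundary M N j (\<lambda>\<sigma>. (\<Sum>i\<in>V. g i * y i) * z \<sigma>)"
  unfolding boundary_def
proof (intro exI conjI allI)
  let ?w = "\<lambda>\<sigma>. \<Sum>i\<in>V. g i * wedge i z \<sigma>"
  show w: "chain M (Suc j) ?w"
    by (intro chain_sum chain_scale chain_wedge M z g)
  fix \<sigma>
  show "(\<Sum>i\<in>V. g i * y i) * z \<sigma> - bd ?w \<sigma> \<in> N"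
  proof (cases "\<sigma> \<subseteq> V")
    case True
    then have "finite \<sigma>" using finite_V finite_subset by blast
    then have "bd ?w \<sigma> = (\<Sum>i\<in>V. g i * (y i * z \<sigma> - wedge i (bd z) \<sigma>))"
      by (simp add: bd_sum bd_scale bd_wedge)
    then have "(\<Sum>i\<in>V. g i * y i) * z \<sigma> - bd ?w \<sigma> = (\<Sum>i\<in>V. g i * wedge i (bd z) \<sigma>)"
      by (simp add: sum_distrib_right right_diff_distrib sum_subtractf mult.assoc)
    then show ?thesis
      by (auto intro!: submod_sum N submod_mult g wedge_mem z)
  next
    case False
    then have "z \<sigma> = 0" "bd ?w \<sigma> = 0"
      using chain_outside[OF z(1)] chain_bd_outside[OF w] by blast+
    then show ?thesis using N by (simp add: submod_0)
  qed
qed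

text \<open>The new class \<open>w\<close> is a preimage of a class killed by \<open>f\<close> under
  the connecting map. It is no boundary: from \<open>w = bd v + n + f * m\<close>, applying
  \<open>bd\<close> gives \<open>f * (z' - bd m) \<in> N\<close>, and regularity would make
  \<open>z'\<close> a boundary modulo \<open>N\<close>.\<close>

lemma koszul_class_step:
  assumes M: "submod M" and N: "submod N" "N \<subseteq> M" and f: "f \<in> R"
    and fL: "f ^ L = (\<Sum>i\<in>V. g i * y i)" and g: "\<And>i. i \<in> V \<Longrightarrow> g i \<in> R"
    and reg: "\<And>m. m \<in> M \<Longrightarrow> f * m \<in> N \<Longrightarrow> m \<in> N"
    and z: "koszul_class M N j z"
  shows "\<exists>w. koszul_class M {n + f * m | n m. n \<in> N \<and> m \<in> M} (Suc j) w"
proof -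
  let ?P = "\<lambda>l. boundary M N j (\<lambda>\<sigma>. f ^ l * z \<sigma>)"
  have "?P L"
    unfolding fL using z by (intro boundary_scale M N g) (auto simp: koszul_class_def)
  moreover have "\<not> ?P 0" using z by (simp add: koszul_class_def)
  \<comment> \<open>The multiples by powers of \<open>f\<close> become boundaries at the latest at
    \<open>L\<close>; \<open>l\<close> is a place where this happens, so \<open>z'\<close> is
    nonzero in homology and killed by \<open>f\<close>.\<close>
  ultimately obtain l where l: "\<not> ?P l" "?P (Suc l)"
    using dec_induct[of 0 L "\<lambda>l. \<not> ?P l"] by blast
  define z' where "z' = (\<lambda>\<sigma>. f ^ l * z \<sigma>)"
  have z': "chain M j z'"
    unfolding z'_def using z by (intro chain_scale M power_R f) (auto simp: koszul_class_def)
  from l(2) obtain w where w: "chain M (Suc j) w" "\<And>\<sigma>. f * z' \<sigma> - bd w \<sigma> \<in> N"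
    unfolding boundary_def z'_def by (auto simp: mult.assoc)
  let ?N' = "{n + f * m | n m. n \<in> N \<and> m \<in> M}"
  have "bd w \<sigma> \<in> ?N'" for \<sigma>
  proof -
    have "bd w \<sigma> = - (f * z' \<sigma> - bd w \<sigma>) + f * z' \<sigma>" by simp
    moreover have "- (f * z' \<sigma> - bd w \<sigma>) \<in> N" by (rule submod_uminus[OF N(1) w(2)])
    moreover have "z' \<sigma> \<in> M" using z' by (simp add: chain_def)
    ultimately show ?thesis by blast
  qed
  moreover have "\<not> boundary M ?N' (Suc j) w"
  proof
    assume "boundary M ?N' (Suc j) w"
    then obtain v where v: "chain M (Suc (Suc j)) v" "\<And>\<sigma>. w \<sigma> - bd v \<sigma> \<in> ?N'"
      by (auto simp: boundary_def)
    have "\<forall>\<sigma>. \<exists>n m. w \<sigma> - bd v \<sigma> = n + f * m \<and> n \<in> N \<and> m \<in> M"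
      using v(2) by blast
    then obtain n m where nm: "\<And>\<sigma>. w \<sigma> - bd v \<sigma> = n \<sigma> + f * m \<sigma>" "\<And>\<sigma>. n \<sigma> \<in> N" "\<And>\<sigma>. m \<sigma> \<in> M"
      by metis
    \<comment> \<open>The chosen coefficients are cut off to the sets of size \<open>Suc j\<close>,
      so that \<open>m'\<close> is a chain. The identity for \<open>w\<close> survives since
      \<open>w\<close> and \<open>bd v\<close> vanish on all other sets.\<close>
    define m' where "m' = (\<lambda>\<sigma>. if \<sigma> \<subseteq> V \<and> card \<sigma> = Suc j then m \<sigma> else 0)"
    define n' where "n' = (\<lambda>\<sigma>. if \<sigma> \<subseteq> V \<and> card \<sigma> = Suc j then n \<sigma> else 0)"
    have w_eq: "w \<sigma> = bd v \<sigma> + (n' \<sigma> + f * m' \<sigma>)" for \<sigma>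
    proof (cases "\<sigma> \<subseteq> V \<and> card \<sigma> = Suc j")
      case True
      then show ?thesis using nm(1)[of \<sigma>] by (simp add: m'_def n'_def algebra_simps)
    next
      case False
      then have "w \<sigma> = 0" "bd v \<sigma> = 0"
        using chain_outside[OF w(1)] chain_bd_outside[OF v(1)] by auto
      with False show ?thesis by (auto simp: m'_def n'_def)
    qed
    have m': "chain M (Suc j) m'"
      using nm(3) M by (auto simp: chain_def m'_def submod_0)
    have "z' \<sigma> - bd m' \<sigma> \<in> N" for \<sigma>
    proof (cases "\<sigma> \<subseteq> V")
      case True
      then have "finite \<sigma>" using finite_V finite_subset by blast
      then have "bd w \<sigma> = bd n' \<sigma> + f * bd m' \<sigma>"
        using w_eq bd_bd[of \<sigma> v] by (subst ext[OF w_eq]) (simp add: bd_add bd_scale)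
      then have "f * (z' \<sigma> - bd m' \<sigma>) = (f * z' \<sigma> - bd w \<sigma>) + bd n' \<sigma>"
        by (simp add: algebra_simps)
      moreover have "bd n' \<sigma> \<in> N"
        using nm(2) by (intro bd_mem N) (auto simp: n'_def submod_0 N)
      ultimately have "f * (z' \<sigma> - bd m' \<sigma>) \<in> N" using w(2) submod_add N by simp
      moreover have "z' \<sigma> - bd m' \<sigma> \<in> M"
        using z' m' by (intro submod_diff bd_mem M) (auto simp: chain_def)
      ultimately show ?thesis using reg by blast
    next
      case False
      then have "z' \<sigma> = 0" "bd m' \<sigma> = 0"
        using chain_outside[OF z'] chain_bd_outside[OF m'] by blast+
      then show ?thesis using N by (simp add: submod_0)
    qed
    then have "boundary M N j z'" using m' by (auto simp: boundary_def)
    then show False using l(1) by (simp add: z'_def)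
  qed
  ultimately show ?thesis using w(1) by (auto simp: koszul_class_def)
qed

text \<open>A nonzero class in degree \<open>j\<close> yields one in degree \<open>j + t\<close> modulo a regular sequence of
  length \<open>t\<close>, and there are no chains in degrees above \<open>card V\<close>.\<close>

lemma regular_sequence_bound:
  assumes M: "submod M" and N0: "submod (N 0)" "N 0 \<subseteq> M"
    and N: "\<And>i. i < t \<Longrightarrow> N (Suc i) = {n + f i * m | n m. n \<in> N i \<and> m \<in> M}"
    and f: "\<And>i. i < t \<Longrightarrow> f i \<in> R"
    and rad: "\<And>i. i < t \<Longrightarrow> \<exists>L g. f i ^ L = (\<Sum>v\<in>V. g v * y v) \<and> (\<forall>v\<in>V. g v \<in> R)"
    and reg: "\<And>i m. i < t \<Longrightarrow> m \<in> M \<Longrightarrow> f i * m \<in> N i \<Longrightarrow> m \<in> N i"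
    and z: "koszul_class M (N 0) j z"
  shows "j + t \<le> card V"
proof -
  have "submod (N i) \<and> N i \<subseteq> M \<and> (\<exists>w. koszul_class M (N i) (j + i) w)" if "i \<le> t" for i
    using that
  proof (induction i)
    case 0
    then show ?case using N0 z by auto
  next
    case (Suc i)
    then have IH: "submod (N i)" "N i \<subseteq> M" and i: "i < t" by auto
    from Suc obtain w where w: "koszul_class M (N i) (j + i) w" by auto
    obtain L g where "f i ^ L = (\<Sum>v\<in>V. g v * y v)" "\<And>v. v \<in> V \<Longrightarrow> g v \<in> R"
      using rad[OF i] by auto
    then have "\<exists>w. koszul_class M (N (Suc i)) (j + Suc i) w"
      unfolding N[OF i] using koszul_class_step[OF M IH f[OF i] _ _ reg[OF i] w] by simp
    moreover have "submod (N (Suc i))"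
      unfolding N[OF i] submod_def
    proof (intro conjI ballI)
      have "0 = 0 + f i * 0" by simp
      then show "0 \<in> {n + f i * m | n m. n \<in> N i \<and> m \<in> M}"
        using submod_0 IH M by blast
    next
      fix a b assume "a \<in> {n + f i * m | n m. n \<in> N i \<and> m \<in> M}" "b \<in> {n + f i * m | n m. n \<in> N i \<and> m \<in> M}"
      then obtain n m n' m' where "a = n + f i * m" "b = n' + f i * m'" "n \<in> N i" "n' \<in> N i" "m \<in> M" "m' \<in> M"
        by auto
      then have "a + b = (n + n') + f i * (m + m')" "n + n' \<in> N i" "m + m' \<in> M"
        using submod_add IH M by (auto simp: algebra_simps)
      then show "a + b \<in> {n + f i * m | n m. n \<in> N i \<and> m \<in> M}" by blast
    next
      fix r a assume "r \<in> R" "a \<in> {n + f i * m | n m. n \<in> N i \<and> m \<in> M}"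
      then obtain n m where "a = n + f i * m" "n \<in> N i" "m \<in> M" by auto
      then have "r * a = r * n + f i * (r * m)" "r * n \<in> N i" "r * m \<in> M"
        using submod_mult IH M \<open>r \<in> R\<close> by (auto simp: distrib_left mult.left_commute)
      then show "r * a \<in> {n + f i * m | n m. n \<in> N i \<and> m \<in> M}" by blast
    qed
    moreover have "N (Suc i) \<subseteq> M"
      unfolding N[OF i] using IH M f[OF i] by (auto intro!: submod_add submod_mult)
    ultimately show ?case by blast
  qed
  then obtain w where w: "koszul_class M (N t) (j + t) w" "submod (N t)" by blast
  show ?thesis
  proof (rule ccontr)
    assume "\<not> ?thesis"
    then have "\<And>\<sigma>. \<sigma> \<subseteq> V \<Longrightarrow> card \<sigma> \<noteq> j + t"
      using card_mono[OF finite_V] by (metis)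
    then have "w \<sigma> = 0" for \<sigma> using w(1) by (auto simp: koszul_class_def chain_def)
    then have "boundary M (N t) (j + t) w"
      using M w(2) unfolding boundary_def
      by (intro exI[of _ "\<lambda>_. 0"]) (auto simp: chain_def submod_0 bd_def)
    then show False using w(1) by (simp add: koszul_class_def)
  qed
qed

end

section \<open>Partitions into boxes\<close>

text \<open>The exponents of the monomials in x^u K[Z], so that disjoint boxes become Stanley spaces
  of dimension \<open>card Z\<close>.\<close>

definition box :: "('v \<Rightarrow> nat) \<Rightarrow> 'v set \<Rightarrow> ('v \<Rightarrow> nat) set" where
  "box u Z = {b. \<forall>i. (i \<in> Z \<longrightarrow> u i \<le> b i) \<and> (i \<notin> Z \<longrightarrow> b i = u i)}"

lemma box_base: "u \<in> box u Z"
  by (simp add: box_def)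

text \<open>A predicate on sets hides the family of boxes, so partitions of pieces can be glued
  without bookkeeping; \<open>box_union_partition\<close> recovers the family.\<close>

inductive box_union :: "'v set \<Rightarrow> nat \<Rightarrow> ('v \<Rightarrow> nat) set \<Rightarrow> bool" for V d where
  empty: "box_union V d {}"
| insert: "Z \<subseteq> V \<Longrightarrow> d \<le> card Z \<Longrightarrow> box_union V d X \<Longrightarrow> box u Z \<inter> X = {} \<Longrightarrow> box_union V d (box u Z \<union> X)"

lemma box_union_box: "Z \<subseteq> V \<Longrightarrow> d \<le> card Z \<Longrightarrow> box_union V d (box u Z)"
  using box_union.insert[OF _ _ box_union.empty, of Z V d u] by simp

lemma box_union_Un:
  "box_union V d X \<Longrightarrow> box_union V d Y \<Longrightarrow> X \<inter> Y = {} \<Longrightarrow> box_union V d (X \<union> Y)"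
proof (induction rule: box_union.induct)
  case (insert Z X u)
  then have "box_union V d (X \<union> Y)" "box u Z \<inter> (X \<union> Y) = {}" by auto
  then show ?case using box_union.insert[of Z V d "X \<union> Y" u] insert by (simp add: Un_assoc)
qed simp

lemma box_union_UN:
  assumes "finite I" "\<And>i. i \<in> I \<Longrightarrow> box_union V d (X i)"
    "\<And>i j. i \<in> I \<Longrightarrow> j \<in> I \<Longrightarrow> i \<noteq> j \<Longrightarrow> X i \<inter> X j = {}"
  shows "box_union V d (\<Union>i\<in>I. X i)"
  using assms
proof (induction I rule: finite_induct)
  case (insert i I)
  have "X i \<inter> (\<Union>i\<in>I. X i) = {}" using insert by blast
  then show ?case using insert by (auto intro!: box_union_Un)
qed (simp add: box_union.empty)

lemma box_union_partition:
  assumes "box_union V d X"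
  shows "\<exists>F. finite F \<and> (\<forall>(u, Z)\<in>F. Z \<subseteq> V \<and> d \<le> card Z) \<and> X = (\<Union>x\<in>F. case_prod box x) \<and>
    (\<forall>x\<in>F. \<forall>y\<in>F. x \<noteq> y \<longrightarrow> case_prod box x \<inter> case_prod box y = {})"
  using assms
proof (induction rule: box_union.induct)
  case empty
  then show ?case by (intro exI[of _ "{}"]) auto
next
  case (insert Z X u)
  then obtain F where F: "finite F" "\<forall>(u, Z)\<in>F. Z \<subseteq> V \<and> d \<le> card Z" "X = (\<Union>x\<in>F. case_prod box x)"
    "\<forall>x\<in>F. \<forall>y\<in>F. x \<noteq> y \<longrightarrow> case_prod box x \<inter> case_prod box y = {}"
    by blast
  have new: "\<forall>x\<in>F. case_prod box x \<inter> case_prod box (u, Z) = {} \<and> case_prod box (u, Z) \<inter> case_prod box x = {}"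
    using insert.hyps(4) F(3) by auto
  have "\<forall>x\<in>insert (u, Z) F. \<forall>y\<in>insert (u, Z) F. x \<noteq> y \<longrightarrow> case_prod box x \<inter> case_prod box y = {}"
  proof (intro ballI impI)
    fix x y assume "x \<in> insert (u, Z) F" "y \<in> insert (u, Z) F" "x \<noteq> y"
    then consider "x = (u, Z)" "y \<in> F" | "y = (u, Z)" "x \<in> F" | "x \<in> F" "y \<in> F" by blast
    then show "case_prod box x \<inter> case_prod box y = {}"
      using F(4) \<open>x \<noteq> y\<close> new by cases metis+
  qed
  then show ?case
    using F(1-3) insert.hyps by (intro exI[of _ "insert (u, Z) F"]) auto
qed

section \<open>Ordered matchings and cover ideals\<close>

text \<open>\<open>adj\<close> is consulted only from \<open>A\<close> to \<open>B\<close>. The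
  order selects first vertices and also fixes the signs of the exterior algebra.\<close>

locale bipartition =
  fixes A B :: "'v::linorder set" and adj :: "'v \<Rightarrow> 'v \<Rightarrow> bool"
  assumes fin: "finite A" "finite B" and disj: "A \<inter> B = {}"
begin

definition covers :: "nat \<Rightarrow> ('v \<Rightarrow> nat) set" where
  "covers k = {b. \<forall>a\<in>A. \<forall>w\<in>B. adj a w \<longrightarrow> k \<le> b a + b w}"

primrec ordered_matching :: "('v \<times> 'v) list \<Rightarrow> bool" where
  "ordered_matching [] \<longleftrightarrow> True"
| "ordered_matching (e # ps) \<longleftrightarrow> fst e \<in> A \<and> snd e \<in> B \<and> adj (fst e) (snd e) \<and>
    fst e \<notin> fst ` set ps \<and> snd e \<notin> snd ` set ps \<and>
    (\<forall>q \<in> snd ` set ps. \<not> adj (fst e) q) \<and> ordered_matching ps"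

lemma ordered_matching_mem:
  "ordered_matching ps \<Longrightarrow> (p, q) \<in> set ps \<Longrightarrow> p \<in> A \<and> q \<in> B \<and> adj p q"
  by (induction ps) auto

lemma ordered_matching_length: "ordered_matching ps \<Longrightarrow> length ps \<le> card A"
proof -
  assume "ordered_matching ps"
  then have "distinct (map fst ps)" "set (map fst ps) \<subseteq> A"
    by (induction ps) auto
  then show ?thesis
    using card_mono[OF fin(1)] distinct_card by (metis length_map)
qed

text \<open>The set \<open>A'\<close> consists of the vertices of \<open>A\<close> on an edge that \<open>box u Z\<close> does not already
  satisfy. The box is split according to the first vertex \<open>v\<close> in \<open>A'\<close> at which the exponent
  attains its minimum \<open>\<tau>\<close>: then all neighbours of \<open>v\<close> need exponents at least \<open>k - \<tau>\<close>, which
  settles every edge meeting them, so that the neighbourhood of \<open>v\<close> can be removed from \<open>B'\<close> at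
  the price of the single dimension \<open>v\<close>. The removed \<open>v\<close> extend ordered matchings of the rest.\<close>

lemma box_union_covers:
  assumes "B' \<subseteq> B" "Z \<subseteq> A \<union> B" "B' \<subseteq> Z"
    and "\<And>a w. a \<in> A \<Longrightarrow> w \<in> B' \<Longrightarrow> adj a w \<Longrightarrow> a \<in> Z"
    and "\<And>a w. a \<in> A \<Longrightarrow> w \<in> B - B' \<Longrightarrow> adj a w \<Longrightarrow> k \<le> u a + u w"
    and "\<And>ps. ordered_matching ps \<Longrightarrow> snd ` set ps \<subseteq> B' \<Longrightarrow> length ps \<le> r"
  shows "box_union (A \<union> B) (card Z - r) (box u Z \<inter> covers k) \<and>
    box_union (A \<union> B) (card Z - Suc r) (box u Z - covers k)"
  using assms
proof (induction r arbitrary: B' Z u)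
  \<comment> \<open>An edge meeting \<open>B'\<close> would be an ordered matching of length 1. So
    every edge is already satisfied by \<open>u\<close>, and the whole box consists of
    covers.\<close>
  case 0
  have "\<not> adj a w" if "a \<in> A" "w \<in> B'" for a w
    using "0.prems"(6)[of "[(a, w)]"] "0.prems"(1) that by auto
  have "box u Z \<subseteq> covers k"
    unfolding covers_def
  proof clarify
    fix b a w assume b: "b \<in> box u Z" and aw: "a \<in> A" "w \<in> B" "adj a w"
    then have "k \<le> u a + u w" using "0.prems"(5) \<open>\<And>w a. a \<in> A \<Longrightarrow> w \<in> B' \<Longrightarrow> \<not> adj a w\<close> by blast
    moreover have "u i \<le> b i" for i using b unfolding box_def by (cases "i \<in> Z") auto
    ultimately show "k \<le> b a + b w" by (meson add_mono le_trans)
  qed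
  then have *: "box u Z \<inter> covers k = box u Z" "box u Z - covers k = {}" by auto
  show ?case unfolding * using "0.prems"(2) by (simp add: box_union_box box_union.empty)
next
  case (Suc r)
  define A' where "A' = {a \<in> A. \<exists>w\<in>B'. adj a w}"
  have A': "A' \<subseteq> A" "A' \<subseteq> Z" using Suc.prems(4) by (auto simp: A'_def)
  have finA': "finite A'" using A' fin finite_subset by blast
  have finZ: "finite Z" using Suc.prems(2) fin finite_subset by blast
  have box_ge: "u i \<le> b i" if "b \<in> box u Z" for b i u and Z :: "'v set"
    using that unfolding box_def by (cases "i \<in> Z") auto
  \<comment> \<open>Where no vertex of \<open>A'\<close> falls below \<open>k\<close>, all open
    edges hold: one box of full dimension. Otherwise the minimum over \<open>A'\<close> is some
    \<open>\<tau> < k\<close>, first attained at some \<open>v\<close>, which gives the piece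
    \<open>P (v, \<tau>)\<close>.\<close>
  define hi where "hi = {b \<in> box u Z. \<forall>a\<in>A'. k \<le> b a}"
  define P where "P = (\<lambda>(v, \<tau>). {b \<in> box u Z. b v = \<tau> \<and> (\<forall>a\<in>A'. \<tau> \<le> b a \<and> (a < v \<longrightarrow> \<tau> < b a))})"
  have hi_box: "hi = box (\<lambda>i. if i \<in> A' then max (u i) k else u i) Z"
    using A' by (auto simp: hi_def box_def)
  have hi_covers: "hi \<subseteq> covers k"
    unfolding covers_def
  proof clarify
    fix b a w assume b: "b \<in> hi" and aw: "a \<in> A" "w \<in> B" "adj a w"
    show "k \<le> b a + b w"
    proof (cases "w \<in> B'")
      case True
      then have "k \<le> b a" using b aw by (auto simp: hi_def A'_def)
      then show ?thesis by simp
    next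
      case False
      then have "k \<le> u a + u w" using Suc.prems(5) aw by blast
      moreover have "u a \<le> b a" "u w \<le> b w" using b box_ge[of b u Z] by (auto simp: hi_def)
      ultimately show ?thesis by linarith
    qed
  qed
  have split: "box u Z = hi \<union> (\<Union>x\<in>A' \<times> {..<k}. P x)"
  proof
    show "hi \<union> (\<Union>x\<in>A' \<times> {..<k}. P x) \<subseteq> box u Z" by (auto simp: hi_def P_def)
    show "box u Z \<subseteq> hi \<union> (\<Union>x\<in>A' \<times> {..<k}. P x)"
    proof
      fix b assume b: "b \<in> box u Z"
      show "b \<in> hi \<union> (\<Union>x\<in>A' \<times> {..<k}. P x)"
      proof (cases "b \<in> hi")
        case False
        then obtain a where a: "a \<in> A'" "b a < k" using b by (auto simp: hi_def not_le)
        define \<tau> where "\<tau> = Min (b ` A')"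
        have \<tau>: "\<tau> \<in> b ` A'" "\<And>a. a \<in> A' \<Longrightarrow> \<tau> \<le> b a"
          using a finA' by (auto simp: \<tau>_def intro!: Min_in)
        define v where "v = Min {a \<in> A'. b a = \<tau>}"
        have "{a \<in> A'. b a = \<tau>} \<noteq> {}" using \<tau>(1) by blast
        then have v: "v \<in> {a \<in> A'. b a = \<tau>}" "\<And>a. a \<in> A' \<Longrightarrow> b a = \<tau> \<Longrightarrow> v \<le> a"
          using Min_in[of "{a \<in> A'. b a = \<tau>}"] finA' unfolding v_def by (simp_all add: Min_le)
        have "\<tau> < b a" if "a \<in> A'" "a < v" for a
          using that \<tau>(2)[of a] v(2)[of a] by force
        moreover have "\<tau> < k" using a \<tau>(2)[of a] by simp
        ultimately have "b \<in> P (v, \<tau>)" "(v, \<tau>) \<in> A' \<times> {..<k}"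
          using b v \<tau> by (auto simp: P_def)
        then show ?thesis by blast
      qed simp
    qed
  qed
  have hi_P: "hi \<inter> P x = {}" if "x \<in> A' \<times> {..<k}" for x
    using that by (fastforce simp: hi_def P_def)
  have P_P: "P x \<inter> P y = {}" if "x \<in> A' \<times> {..<k}" "y \<in> A' \<times> {..<k}" "x \<noteq> y" for x y
  proof (rule ccontr)
    assume "P x \<inter> P y \<noteq> {}"
    then obtain b where b: "b \<in> P x" "b \<in> P y" by blast
    obtain v \<tau> v' \<tau>' where xy: "x = (v, \<tau>)" "y = (v', \<tau>')" by fastforce
    have x: "b v = \<tau>" "\<forall>a\<in>A'. \<tau> \<le> b a \<and> (a < v \<longrightarrow> \<tau> < b a)" "v \<in> A'"
      and y: "b v' = \<tau>'" "\<forall>a\<in>A'. \<tau>' \<le> b a \<and> (a < v' \<longrightarrow> \<tau>' < b a)" "v' \<in> A'"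
      using b that xy by (simp_all add: P_def)
    then have "\<tau> = \<tau>'" by (metis le_antisym)
    moreover have "\<not> v < v'" "\<not> v' < v" using x y calculation by auto
    ultimately show False using that xy by simp
  qed
  have r_pos: "box_union (A \<union> B) (card Z - Suc r) (P x \<inter> covers k) \<and>
      box_union (A \<union> B) (card Z - Suc (Suc r)) (P x - covers k)" if x: "x \<in> A' \<times> {..<k}" for x
  proof -
    obtain v \<tau> where x_eq: "x = (v, \<tau>)" by fastforce
    then have v: "v \<in> A'" "v \<in> A" "v \<in> Z" and \<tau>: "\<tau> < k" using x A' by auto
    show ?thesis
    proof (cases "\<tau> < u v")
      \<comment> \<open>If the base already exceeds \<open>\<tau>\<close> at \<open>v\<close>, the
        piece is empty; excluding this makes \<open>u1\<close> dominate \<open>u\<close>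
        below.\<close>
      case True
      then have "P x = {}" using box_ge[of _ u Z v] by (fastforce simp: P_def x_eq)
      then show ?thesis by (simp add: box_union.empty)
    next
      case False
      define Z1 where "Z1 = Z - {v}"
      \<comment> \<open>Coordinate \<open>v\<close> is frozen at \<open>\<tau>\<close>; the strict
        bound for vertices before \<open>v\<close> records that \<open>v\<close> is the first
        minimum.\<close>
      define u1 where "u1 = (\<lambda>i. if i = v then \<tau> else
        if i \<in> A' then max (u i) (if i < v then Suc \<tau> else \<tau>) else u i)"
      have u_u1: "u i \<le> u1 i" for i using False by (auto simp: u1_def)
      have P_box: "P x = box u1 Z1"
      proof (intro Set.set_eqI iffI)
        fix b assume "b \<in> P x"
        then show "b \<in> box u1 Z1" by (auto simp: P_def x_eq box_def u1_def Z1_def Suc_le_eq)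
      next
        fix b assume b: "b \<in> box u1 Z1"
        have bv: "b v = \<tau>" using b by (auto simp: box_def u1_def Z1_def)
        have "u i \<le> b i" for i
          using box_ge[OF b, of i] u_u1[of i] by simp
        moreover have "b i = u i" if "i \<notin> Z" for i
        proof -
          have "b i = u1 i" using b that by (simp add: box_def Z1_def)
          moreover have "i \<noteq> v" "i \<notin> A'" using that v A' by auto
          ultimately show ?thesis by (simp add: u1_def)
        qed
        moreover have "\<tau> \<le> b a \<and> (a < v \<longrightarrow> \<tau> < b a)" if "a \<in> A'" for a
        proof (cases "a = v")
          case False
          then show ?thesis using box_ge[OF b, of a] that by (simp add: u1_def split: if_splits)
        qed (use bv in auto)
        ultimately show "b \<in> P x" using bv by (auto simp: P_def x_eq box_def)
      qed
      define N where "N = {w \<in> B'. adj v w}"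
      have N: "N \<noteq> {}" "N \<subseteq> B'" "finite N" "v \<notin> N" "N \<subseteq> Z1"
        using v A' Suc.prems(1,3) fin disj finite_subset[of N B] by (auto simp: N_def A'_def Z1_def)
      \<comment> \<open>Since \<open>v\<close> is frozen at \<open>\<tau>\<close>, a cover in this
        piece has at least \<open>k - \<tau>\<close> on all of \<open>N\<close>, so passing to
        \<open>u2\<close> loses no cover.\<close>
      define u2 where "u2 = (\<lambda>i. if i \<in> N then max (u1 i) (k - \<tau>) else u1 i)"
      have u2_box: "box u2 Z1 = {b \<in> box u1 Z1. \<forall>w\<in>N. k - \<tau> \<le> b w}"
        using N by (auto simp: u2_def box_def)
      \<comment> \<open>Freezing \<open>v\<close> costs one dimension, which is exactly compensated
        by the drop from \<open>Suc r\<close> to \<open>r\<close>.\<close>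
      have card_Z1: "card Z1 - r = card Z - Suc r" "card Z1 - Suc r = card Z - Suc (Suc r)"
        using v finZ by (simp_all add: Z1_def)
      have IH: "box_union (A \<union> B) (card Z1 - r) (box u2 Z1 \<inter> covers k) \<and>
          box_union (A \<union> B) (card Z1 - Suc r) (box u2 Z1 - covers k)"
      proof (rule Suc.IH[of "B' - N"])
        show "B' - N \<subseteq> B" "Z1 \<subseteq> A \<union> B" using Suc.prems(1,2) by (auto simp: Z1_def)
        show "B' - N \<subseteq> Z1" using Suc.prems(1,3) v disj by (auto simp: Z1_def)
        show "a \<in> Z1" if "a \<in> A" "w \<in> B' - N" "adj a w" for a w
          using that Suc.prems(4)[of a w] by (auto simp: Z1_def N_def)
        show "k \<le> u2 a + u2 w" if aw: "a \<in> A" "w \<in> B - (B' - N)" "adj a w" for a w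
        proof (cases "w \<in> N")
          case True
          then have "a \<in> A'" using aw by (auto simp: N_def A'_def)
          then have "\<tau> \<le> u2 a" by (auto simp: u2_def u1_def)
          moreover have "k - \<tau> \<le> u2 w" using True by (simp add: u2_def)
          ultimately show ?thesis by linarith
        next
          case False
          then have "k \<le> u a + u w" using aw Suc.prems(5) by blast
          moreover have "u a \<le> u2 a" "u w \<le> u2 w" using u_u1 by (auto simp: u2_def intro: le_max_iff_disj[THEN iffD2])
          ultimately show ?thesis by linarith
        qed
        show "length ps \<le> r" if ps: "ordered_matching ps" "snd ` set ps \<subseteq> B' - N" for ps
        proof -
          obtain w where w: "w \<in> N" using N by blast
          have nadj: "\<not> adj v q" if "q \<in> snd ` set ps" for q
            using that ps(2) by (auto simp: N_def)
          then have "v \<notin> fst ` set ps"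
            using ordered_matching_mem[OF ps(1)] by force
          \<comment> \<open>All neighbours of \<open>v\<close> in \<open>B'\<close> were removed, so
            \<open>v\<close> has none among the later second entries and the pair may be put in
            front.\<close>
          then have "ordered_matching ((v, w) # ps)"
            using ps nadj v w Suc.prems(1) by (auto simp: N_def)
          moreover have "snd ` set ((v, w) # ps) \<subseteq> B'" using w ps N by auto
          ultimately have "length ((v, w) # ps) \<le> Suc r" by (rule Suc.prems(6))
          then show ?thesis by simp
        qed
      qed
      \<comment> \<open>The exponents failing the bound \<open>k - \<tau>\<close> on
        \<open>N\<close> violate an edge at \<open>v\<close>. They are sorted by the first vertex
        \<open>w\<close> that fails and its value; freezing \<open>w\<close> is the one extra
        dimension lost in the complement.\<close>
      define Q where "Q = (\<lambda>(w, \<rho>). {b \<in> box u1 Z1. b w = \<rho> \<and> (\<forall>x\<in>N. x < w \<longrightarrow> k - \<tau> \<le> b x)})"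
      have b_v: "b v = \<tau>" if "b \<in> box u1 Z1" for b
        using that by (auto simp: box_def Z1_def u1_def)
      have in_covers: "k - \<tau> \<le> b w" if "b \<in> box u1 Z1" "b \<in> covers k" "w \<in> N" for b w
        using that b_v[OF that(1)] v Suc.prems(1) by (fastforce simp: covers_def N_def)
      have eq1: "P x \<inter> covers k = box u2 Z1 \<inter> covers k"
        using in_covers by (auto simp: P_box u2_box)
      have eq2: "P x - covers k = (box u2 Z1 - covers k) \<union> (\<Union>y\<in>N \<times> {..<k - \<tau>}. Q y)"
      proof (intro Set.set_eqI iffI)
        fix b assume b: "b \<in> P x - covers k"
        show "b \<in> (box u2 Z1 - covers k) \<union> (\<Union>y\<in>N \<times> {..<k - \<tau>}. Q y)"
        proof (cases "b \<in> box u2 Z1")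
          case False
          then have ne: "{w \<in> N. b w < k - \<tau>} \<noteq> {}" using b by (auto simp: P_box u2_box not_le)
          define w where "w = Min {w \<in> N. b w < k - \<tau>}"
          have "w \<in> {w \<in> N. b w < k - \<tau>}" using ne N unfolding w_def by (intro Min_in) auto
          moreover have "k - \<tau> \<le> b y" if "y \<in> N" "y < w" for y
          proof (rule ccontr)
            assume "\<not> ?thesis"
            then have "w \<le> y" using that N unfolding w_def by (intro Min_le) auto
            then show False using that by simp
          qed
          ultimately have "b \<in> Q (w, b w)" "(w, b w) \<in> N \<times> {..<k - \<tau>}"
            using b by (auto simp: Q_def P_box)
          then show ?thesis by blast
        qed (use b in auto)
      next
        fix b assume b: "b \<in> (box u2 Z1 - covers k) \<union> (\<Union>y\<in>N \<times> {..<k - \<tau>}. Q y)"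
        show "b \<in> P x - covers k"
        proof (cases "b \<in> box u2 Z1 - covers k")
          case True
          then show ?thesis by (auto simp: P_box u2_box)
        next
          case False
          then obtain w where w: "w \<in> N" "b w < k - \<tau>" "b \<in> box u1 Z1"
            using b by (auto simp: Q_def)
          then show ?thesis using in_covers[of b w] by (auto simp: P_box)
        qed
      qed
      have Q_box: "box_union (A \<union> B) (card Z1 - Suc r) (Q y)" if y: "y \<in> N \<times> {..<k - \<tau>}" for y
      proof -
        obtain w \<rho> where y_eq: "y = (w, \<rho>)" by fastforce
        then have w: "w \<in> N" "w \<in> Z1" using y N by auto
        show ?thesis
        proof (cases "\<rho> < u1 w")
          case True
          then have "Q y = {}" using box_ge[of _ u1 Z1 w] by (fastforce simp: Q_def y_eq)
          then show ?thesis by (simp add: box_union.empty)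
        next
          case False
          define u3 where "u3 = (\<lambda>i. if i = w then \<rho> else
            if i \<in> N \<and> i < w then max (u1 i) (k - \<tau>) else u1 i)"
          have "Q y = box u3 (Z1 - {w})"
          proof (intro Set.set_eqI iffI)
            fix b assume "b \<in> Q y"
            then show "b \<in> box u3 (Z1 - {w})" by (auto simp: Q_def y_eq box_def u3_def)
          next
            fix b assume b: "b \<in> box u3 (Z1 - {w})"
            have bw: "b w = \<rho>" using b by (auto simp: box_def u3_def)
            have "u1 i \<le> u3 i" for i using False by (auto simp: u3_def)
            then have "u1 i \<le> b i" for i
              using box_ge[OF b, of i] le_trans by blast
            moreover have "b i = u1 i" if "i \<notin> Z1" for i
            proof -
              have "b i = u3 i" using b that by (simp add: box_def)
              moreover have "i \<noteq> w" "i \<notin> N" using that w N by auto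
              ultimately show ?thesis by (simp add: u3_def)
            qed
            moreover have "k - \<tau> \<le> b x" if "x \<in> N" "x < w" for x
            proof -
              have "u3 x = max (u1 x) (k - \<tau>)" using that by (auto simp: u3_def)
              then show ?thesis using box_ge[OF b, of x] by simp
            qed
            ultimately show "b \<in> Q y" using bw by (auto simp: Q_def y_eq box_def)
          qed
          moreover have "card Z1 - Suc r \<le> card (Z1 - {w})"
            using w finZ by (simp add: Z1_def)
          ultimately show ?thesis
            using Suc.prems(2) by (auto simp: Z1_def intro!: box_union_box)
        qed
      qed
      have Q_Q: "Q y \<inter> Q y' = {}" if "y \<in> N \<times> {..<k - \<tau>}" "y' \<in> N \<times> {..<k - \<tau>}" "y \<noteq> y'" for y y'
      proof (rule ccontr)
        assume "Q y \<inter> Q y' \<noteq> {}"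
        then obtain b where b: "b \<in> Q y" "b \<in> Q y'" by blast
        obtain w \<rho> w' \<rho>' where yy: "y = (w, \<rho>)" "y' = (w', \<rho>')" by fastforce
        have "\<not> w < w'" "\<not> w' < w" using b that by (auto simp: Q_def yy)
        then show False using that b by (auto simp: Q_def yy)
      qed
      have "box_union (A \<union> B) (card Z1 - Suc r) (P x - covers k)"
        unfolding eq2
      proof (rule box_union_Un)
        show "box_union (A \<union> B) (card Z1 - Suc r) (\<Union>y\<in>N \<times> {..<k - \<tau>}. Q y)"
          using Q_Q Q_box N by (intro box_union_UN) auto
        show "(box u2 Z1 - covers k) \<inter> (\<Union>y\<in>N \<times> {..<k - \<tau>}. Q y) = {}"
          by (fastforce simp: u2_box Q_def)
      qed (use IH in blast)
      then show ?thesis using IH by (simp only: eq1 card_Z1)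
    qed
  qed
  have "box u Z \<inter> covers k = hi \<union> (\<Union>x\<in>A' \<times> {..<k}. P x \<inter> covers k)"
    using split hi_covers by blast
  moreover have "box_union (A \<union> B) (card Z - Suc r) (hi \<union> (\<Union>x\<in>A' \<times> {..<k}. P x \<inter> covers k))"
  proof (rule box_union_Un)
    show "box_union (A \<union> B) (card Z - Suc r) hi"
      unfolding hi_box using Suc.prems(2) by (intro box_union_box) auto
    show "box_union (A \<union> B) (card Z - Suc r) (\<Union>x\<in>A' \<times> {..<k}. P x \<inter> covers k)"
    proof (rule box_union_UN)
      show "(P x \<inter> covers k) \<inter> (P y \<inter> covers k) = {}"
        if "x \<in> A' \<times> {..<k}" "y \<in> A' \<times> {..<k}" "x \<noteq> y" for x y
        using P_P[OF that] by blast
    qed (use r_pos finA' in auto)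
    show "hi \<inter> (\<Union>x\<in>A' \<times> {..<k}. P x \<inter> covers k) = {}" using hi_P by blast
  qed
  moreover have "box u Z - covers k = (\<Union>x\<in>A' \<times> {..<k}. P x - covers k)"
    using split hi_covers by blast
  moreover have "box_union (A \<union> B) (card Z - Suc (Suc r)) (\<Union>x\<in>A' \<times> {..<k}. P x - covers k)"
  proof (rule box_union_UN)
    show "(P x - covers k) \<inter> (P y - covers k) = {}"
      if "x \<in> A' \<times> {..<k}" "y \<in> A' \<times> {..<k}" "x \<noteq> y" for x y
      using P_P[OF that] by blast
  qed (use r_pos finA' in auto)
  ultimately show ?case by simp
qed

end

section \<open>Monomial ideals\<close>

text \<open>Sets of exponents are sets of functions, so that the boxes above apply; a monomial \<open>t\<close> is
  identified with \<open>lookup t\<close>.\<close>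

abbreviation expo :: "('v \<Rightarrow>\<^sub>0 nat) \<Rightarrow> 'v \<Rightarrow> nat" where
  "expo \<equiv> Poly_Mapping.lookup"

text \<open>Allowing arbitrary exponent sets treats ideals, boxes and complements of ideals
  alike.\<close>

definition pspan :: "('v \<Rightarrow> nat) set \<Rightarrow> ('v, 'k::field) mpoly set" where
  "pspan X = {p. \<forall>t\<in>Poly_Mapping.keys p. expo t \<in> X}"

definition supported :: "'v set \<Rightarrow> ('v \<Rightarrow> nat) set" where
  "supported V = {b. \<forall>i. i \<notin> V \<longrightarrow> b i = 0}"

text \<open>Represents x^u only if \<open>u\<close> has finite support, which
  \<open>expo_Abs\<close> derives from membership in \<open>supported V\<close> for finite
  \<open>V\<close>.\<close>

definition monom :: "('v \<Rightarrow> nat) \<Rightarrow> ('v, 'k::field) mpoly" where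
  "monom u = Poly_Mapping.single (Abs_poly_mapping u) 1"

definition restr :: "('v \<Rightarrow> nat) set \<Rightarrow> ('v, 'k::field) mpoly \<Rightarrow> ('v, 'k) mpoly" where
  "restr X p = (\<Sum>t\<in>{t \<in> Poly_Mapping.keys p. expo t \<in> X}. Poly_Mapping.single t (Poly_Mapping.lookup p t))"

lemma expo_Abs: "finite V \<Longrightarrow> u \<in> supported V \<Longrightarrow> expo (Abs_poly_mapping u) = u"
  by (rule lookup_Abs_poly_mapping) (auto simp: supported_def elim!: finite_subset[rotated])

lemma expo_add: "expo (s + t) = (\<lambda>i. expo s i + expo t i)"
  by (auto simp: lookup_add)

lemma lookup_restr: "Poly_Mapping.lookup (restr X p) t = (if expo t \<in> X then Poly_Mapping.lookup p t else 0)"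
proof -
  have "Poly_Mapping.lookup (restr X p) t
      = (\<Sum>s\<in>{t \<in> Poly_Mapping.keys p. expo t \<in> X}. if s = t then Poly_Mapping.lookup p t else 0)"
    unfolding restr_def lookup_sum by (rule sum.cong) (auto simp: lookup_single when_def)
  then show ?thesis by (auto simp: in_keys_iff)
qed

lemma restr_mem: "restr X p \<in> pspan X"
  by (auto simp: pspan_def in_keys_iff lookup_restr split: if_splits)

lemma restr_eq: "p \<in> pspan X \<Longrightarrow> restr X p = p"
  by (rule poly_mapping_eqI) (auto simp: lookup_restr pspan_def in_keys_iff)

lemma sum_singles:
  fixes p :: "('v, 'k::field) mpoly"
  shows "p = (\<Sum>t\<in>Poly_Mapping.keys p. Poly_Mapping.single t (Poly_Mapping.lookup p t))"
  using restr_eq[of p UNIV] by (simp add: pspan_def restr_def)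

lemma pspan_0: "0 \<in> pspan X"
  by (simp add: pspan_def)

lemma pspan_add: "p \<in> pspan X \<Longrightarrow> q \<in> pspan X \<Longrightarrow> p + q \<in> pspan X"
  using Poly_Mapping.keys_add[of p q] by (auto simp: pspan_def)

lemma pspan_uminus: "p \<in> pspan X \<Longrightarrow> - p \<in> pspan X"
  by (auto simp: pspan_def in_keys_iff)

lemma pspan_diff: "p \<in> pspan X \<Longrightarrow> q \<in> pspan X \<Longrightarrow> p - q \<in> pspan X"
  using pspan_add[OF _ pspan_uminus, of p X q] by simp

lemma pspan_sum: "(\<And>a. a \<in> A \<Longrightarrow> g a \<in> pspan X) \<Longrightarrow> sum g A \<in> pspan X"
  by (induction A rule: infinite_finite_induct) (auto simp: pspan_0 pspan_add)

lemma pspan_mono: "X \<subseteq> Y \<Longrightarrow> pspan X \<subseteq> pspan Y"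
  by (auto simp: pspan_def)

lemma pspan_single: "c \<noteq> 0 \<Longrightarrow> Poly_Mapping.single t c \<in> pspan X \<longleftrightarrow> expo t \<in> X"
  by (simp add: pspan_def)

lemma pspan_singleI: "expo t \<in> X \<Longrightarrow> Poly_Mapping.single t c \<in> pspan X"
  by (cases "c = 0") (auto simp: pspan_single pspan_0)

lemma pspan_mult:
  assumes "p \<in> pspan X" "q \<in> pspan Y" "\<And>x y. x \<in> X \<Longrightarrow> y \<in> Y \<Longrightarrow> (\<lambda>i. x i + y i) \<in> W"
  shows "p * q \<in> pspan W"
  unfolding pspan_def
proof clarify
  fix t assume "t \<in> Poly_Mapping.keys (p * q)"
  then obtain a b where "t = a + b" "a \<in> Poly_Mapping.keys p" "b \<in> Poly_Mapping.keys q"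
    using keys_mult[of p q] by auto
  then show "expo t \<in> W" using assms by (auto simp: pspan_def expo_add)
qed

lemma pspan_disjoint: "X \<inter> Y = {} \<Longrightarrow> p \<in> pspan X \<Longrightarrow> p \<in> pspan Y \<Longrightarrow> p = 0"
proof -
  assume "X \<inter> Y = {}" "p \<in> pspan X" "p \<in> pspan Y"
  then have "Poly_Mapping.keys p = {}" unfolding pspan_def by blast
  then show "p = 0" by (intro poly_mapping_eqI) (auto simp: in_keys_iff)
qed

lemma lookup_mult_single:
  "Poly_Mapping.lookup (p * Poly_Mapping.single s (1::'k::field)) (t + s) = Poly_Mapping.lookup p (t :: 'v \<Rightarrow>\<^sub>0 nat)"
proof -
  have "p * Poly_Mapping.single s 1
      = (\<Sum>r\<in>Poly_Mapping.keys p. Poly_Mapping.single (r + s) (Poly_Mapping.lookup p r))"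
    by (subst sum_singles[of p]) (simp add: sum_distrib_right mult_single)
  then have "Poly_Mapping.lookup (p * Poly_Mapping.single s 1) (t + s)
      = (\<Sum>r\<in>Poly_Mapping.keys p. if r = t then Poly_Mapping.lookup p t else 0)"
    by (simp add: lookup_sum lookup_single when_def cong: sum.cong if_cong)
  then show ?thesis by (simp add: in_keys_iff)
qed

lemma lookup_mult_single_0:
  assumes "\<And>r. t \<noteq> r + s"
  shows "Poly_Mapping.lookup (p * Poly_Mapping.single s (1::'k::field)) t = 0"
  using keys_mult[of p "Poly_Mapping.single s 1"] assms by (force simp: in_keys_iff)

lemma mult_monom_inj:
  "p * Poly_Mapping.single s (1::'k::field) = q * Poly_Mapping.single s 1 \<Longrightarrow> p = (q :: ('v, 'k) mpoly)"
  by (rule poly_mapping_eqI) (metis lookup_mult_single)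

lemma expo_supported: "expo t \<in> supported V \<longleftrightarrow> Poly_Mapping.keys t \<subseteq> V"
  by (auto simp: supported_def in_keys_iff)

lemma carrier_mpoly_ring: "carrier (mpoly_ring V) = pspan (supported V)"
  by (simp add: mpoly_ring_def pspan_def expo_supported)

lemma mpoly_ring_simps [simp]:
  "mult (mpoly_ring V) = (*)" "one (mpoly_ring V) = 1" "zero (mpoly_ring V) = 0" "add (mpoly_ring V) = (+)"
  by (simp_all add: mpoly_ring_def)

lemma supported_add: "x \<in> supported V \<Longrightarrow> y \<in> supported V \<Longrightarrow> (\<lambda>i. x i + y i) \<in> supported V"
  by (simp add: supported_def)

lemma pspan_1: "1 \<in> pspan (supported V)"
  by (simp add: pspan_def supported_def)

lemma pspan_supported_mult:
  "p \<in> pspan (supported V) \<Longrightarrow> q \<in> pspan (supported V) \<Longrightarrow> p * q \<in> pspan (supported V)"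
  by (rule pspan_mult) (auto intro: supported_add)

lemma cring_mpoly_ring: "cring (mpoly_ring V)"
proof (rule cringI)
  show "abelian_group (mpoly_ring V)"
  proof (rule abelian_groupI)
    fix x assume "x \<in> carrier (mpoly_ring V)"
    then show "\<exists>y\<in>carrier (mpoly_ring V). y \<oplus>\<^bsub>mpoly_ring V\<^esub> x = \<zero>\<^bsub>mpoly_ring V\<^esub>"
      by (intro bexI[of _ "- x"]) (auto simp: carrier_mpoly_ring pspan_uminus)
  qed (auto simp: carrier_mpoly_ring pspan_add pspan_0 algebra_simps)
  show "Group.comm_monoid (mpoly_ring V)"
    by (rule comm_monoidI) (auto simp: carrier_mpoly_ring pspan_1 pspan_supported_mult algebra_simps)
qed (auto simp: algebra_simps)

text \<open>The exponent sets of monomial ideals of K[x_i | i \<in> V].\<close>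

definition upward_closed :: "'v set \<Rightarrow> ('v \<Rightarrow> nat) set \<Rightarrow> bool" where
  "upward_closed V X \<longleftrightarrow> X \<subseteq> supported V \<and> (\<forall>x\<in>X. \<forall>y\<in>supported V. (\<lambda>i. x i + y i) \<in> X)"

lemma pspan_upward_mult:
  "upward_closed V X \<Longrightarrow> r \<in> pspan (supported V) \<Longrightarrow> p \<in> pspan X \<Longrightarrow> r * p \<in> pspan X"
  by (subst mult.commute, rule pspan_mult) (auto simp: upward_closed_def)

lemma ideal_pspan:
  assumes "upward_closed V X"
  shows "ideal (pspan X :: ('v, 'k::field) mpoly set) (mpoly_ring V)"
proof -
  interpret cring "mpoly_ring V :: ('v, 'k) mpoly ring" by (rule cring_mpoly_ring)
  show ?thesis
  proof (rule idealI)
    show "ring (mpoly_ring V :: ('v, 'k) mpoly ring)" by (rule ring_axioms)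
    show "subgroup (pspan X :: ('v, 'k) mpoly set) (add_monoid (mpoly_ring V))"
    proof (rule group.subgroupI[OF a_group])
      show "(pspan X :: ('v, 'k) mpoly set) \<subseteq> carrier (add_monoid (mpoly_ring V))"
        using assms pspan_mono by (auto simp: upward_closed_def carrier_mpoly_ring)
      fix p :: "('v, 'k) mpoly" assume p: "p \<in> pspan X"
      have "\<ominus>\<^bsub>mpoly_ring V\<^esub> p = - p"
        using p assms pspan_mono[of X "supported V"]
        by (intro minus_equality) (auto simp: carrier_mpoly_ring upward_closed_def pspan_uminus)
      then show "inv\<^bsub>add_monoid (mpoly_ring V)\<^esub> p \<in> pspan X"
        using p by (simp add: a_inv_def pspan_uminus)
    qed (auto simp: pspan_add intro: pspan_0)
  next
    fix p r :: "('v, 'k) mpoly" assume "p \<in> pspan X" "r \<in> carrier (mpoly_ring V)"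
    then show "r \<otimes>\<^bsub>mpoly_ring V\<^esub> p \<in> pspan X" "p \<otimes>\<^bsub>mpoly_ring V\<^esub> r \<in> pspan X"
      using pspan_upward_mult[OF assms, of r p] by (simp_all add: carrier_mpoly_ring mult.commute)
  qed
qed

lemma ideal_sum_mem:
  assumes "ideal I (mpoly_ring V)" "\<And>a. a \<in> A \<Longrightarrow> g a \<in> I"
  shows "sum g A \<in> I"
proof -
  interpret additive_subgroup I "mpoly_ring V" using assms(1) by (rule ideal.axioms)
  show ?thesis
    using assms(2) zero_closed a_closed by (induction A rule: infinite_finite_induct) auto
qed

text \<open>Each monomial of the span is divisible by some x_i with \<open>i \<in> e\<close>, which
  puts it into the ideal. Applied to the edges and to the maximal ideal.\<close>

lemma Idl_var:
  assumes "e \<subseteq> V"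
  shows "Idl\<^bsub>mpoly_ring V\<^esub> (var ` e) = (pspan {b \<in> supported V. \<exists>i\<in>e. b i \<noteq> 0} :: ('v, 'k::field) mpoly set)"
    (is "?I = pspan ?X")
proof
  interpret cring "mpoly_ring V :: ('v, 'k) mpoly ring" by (rule cring_mpoly_ring)
  have up: "upward_closed V ?X" by (auto simp: upward_closed_def supported_def)
  have var: "var ` e \<subseteq> (pspan ?X :: ('v, 'k) mpoly set)"
    using assms by (auto simp: var_def pspan_def supported_def lookup_single when_def)
  then show "?I \<subseteq> pspan ?X" by (intro genideal_minimal ideal_pspan up)
  have "pspan ?X \<subseteq> (pspan (supported V) :: ('v, 'k) mpoly set)" by (rule pspan_mono) auto
  then have "var ` e \<subseteq> carrier (mpoly_ring V :: ('v, 'k) mpoly ring)"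
    using var by (simp add: carrier_mpoly_ring)
  then have I: "ideal ?I (mpoly_ring V)" "var ` e \<subseteq> ?I"
    by (rule genideal_ideal, rule genideal_self)
  show "pspan ?X \<subseteq> ?I"
  proof
    fix p :: "('v, 'k) mpoly" assume p: "p \<in> pspan ?X"
    have "Poly_Mapping.single t c \<in> ?I" if t: "t \<in> Poly_Mapping.keys p" for t c
    proof -
      obtain i where i: "i \<in> e" "expo t i \<noteq> 0" and sup: "expo t \<in> supported V"
        using p t by (auto simp: pspan_def)
      let ?s = "t - Poly_Mapping.single i 1"
      have s: "?s + Poly_Mapping.single i 1 = t"
        using i by (intro poly_mapping_eqI) (auto simp: lookup_add lookup_minus lookup_single when_def)
      have "expo ?s \<in> supported V" using sup by (auto simp: supported_def lookup_minus)
      then have "Poly_Mapping.single ?s c \<in> carrier (mpoly_ring V)"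
        by (simp add: carrier_mpoly_ring pspan_singleI)
      then have "Poly_Mapping.single ?s c \<otimes>\<^bsub>mpoly_ring V\<^esub> var i \<in> ?I"
        using I i by (intro ideal.I_l_closed) auto
      moreover have "Poly_Mapping.single ?s c * var i = Poly_Mapping.single t c"
        unfolding var_def mult_single s by simp
      ultimately show ?thesis by simp
    qed
    then have "(\<Sum>t\<in>Poly_Mapping.keys p. Poly_Mapping.single t (Poly_Mapping.lookup p t)) \<in> ?I"
      by (intro ideal_sum_mem[OF I(1)]) auto
    then show "p \<in> ?I" using sum_singles[of p] by simp
  qed
qed

text \<open>Products of monomial ideals correspond to Minkowski sums of exponent sets;
  \<open>add\<close> and \<open>split\<close> say that \<open>W\<close> is this sum.\<close>

lemma ideal_prod_pspan:
  fixes W :: "('v \<Rightarrow> nat) set"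
  assumes V: "finite V" "X \<subseteq> supported V" "Y \<subseteq> supported V"
    and add: "\<And>x y. x \<in> X \<Longrightarrow> y \<in> Y \<Longrightarrow> (\<lambda>i. x i + y i) \<in> W"
    and split: "\<And>w. w \<in> W \<Longrightarrow> \<exists>x\<in>X. \<exists>y\<in>Y. w = (\<lambda>i. x i + y i)"
  shows "ideal_prod (mpoly_ring V) (pspan X) (pspan Y) = (pspan W :: ('v, 'k::field) mpoly set)" (is "?P = _")
proof
  show "?P \<subseteq> pspan W"
  proof
    fix p assume "p \<in> ?P"
    then show "p \<in> pspan W"
    proof (induction rule: ideal_prod.induct)
      case (prod i j)
      then show ?case using pspan_mult[OF _ _ add] by simp
    qed (simp add: pspan_add)
  qed
  show "pspan W \<subseteq> ?P"
  proof
    fix p :: "('v, 'k) mpoly" assume p: "p \<in> pspan W"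
    have zero: "0 \<in> ?P"
      using ideal_prod.prod[of 0 "pspan X" 0 "pspan Y" "mpoly_ring V"] by (simp add: pspan_0)
    have mem: "Poly_Mapping.single t c \<in> ?P" if t: "t \<in> Poly_Mapping.keys p" for t c
    proof -
      obtain x y where xy: "x \<in> X" "y \<in> Y" "expo t = (\<lambda>i. x i + y i)"
        using p t split by (auto simp: pspan_def) blast
      have "expo (Abs_poly_mapping x) = x" "expo (Abs_poly_mapping y) = y"
        using xy V expo_Abs by blast+
      moreover from this have "t = Abs_poly_mapping x + Abs_poly_mapping y"
        using xy by (intro poly_mapping_eqI) (simp add: lookup_add)
      ultimately show ?thesis
        using ideal_prod.prod[of "Poly_Mapping.single (Abs_poly_mapping x) c" "pspan X"
            "Poly_Mapping.single (Abs_poly_mapping y) 1" "pspan Y" "mpoly_ring V"] xy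
        by (simp add: pspan_singleI mult_single)
    qed
    have "(\<Sum>t\<in>T. Poly_Mapping.single t (Poly_Mapping.lookup p t)) \<in> ?P"
      if "finite T" "T \<subseteq> Poly_Mapping.keys p" for T
      using that
    proof (induction T rule: finite_induct)
      case (insert t T)
      then show ?case
        using ideal_prod.sum[OF mem[of t], of "\<Sum>t\<in>T. Poly_Mapping.single t (Poly_Mapping.lookup p t)"]
        by simp
    qed (simp add: zero)
    then show "p \<in> ?P" using sum_singles[of p] by (metis finite_keys order_refl)
  qed
qed

section \<open>Exponents of the powers of the cover ideal\<close>

context bipartition
begin

definition cover_exps :: "nat \<Rightarrow> ('v \<Rightarrow> nat) set" where
  "cover_exps k = supported (A \<union> B) \<inter> covers k"

lemma upward_closed_cover_exps: "upward_closed (A \<union> B) (cover_exps k)"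
  unfolding upward_closed_def cover_exps_def covers_def
  by (auto simp: supported_def) (metis add.assoc add.commute trans_le_add1)

text \<open>The cover \<open>y\<close> split off from \<open>w\<close> contains exactly one endpoint of each edge with
  \<open>w\<^sub>a + w\<^sub>b = k + 1\<close>. This is where bipartiteness is used.\<close>

lemma cover_exps_Suc:
  assumes "w \<in> cover_exps (Suc k)"
  shows "\<exists>x\<in>cover_exps k. \<exists>y\<in>cover_exps 1. w = (\<lambda>i. x i + y i)"
proof -
  \<comment> \<open>On an edge with \<open>w a = 0\<close> the other end is at least
    \<open>Suc k\<close>, so \<open>y\<close> is a cover. If \<open>y\<close> takes both ends of an
    edge, then \<open>w\<close> has sum at least \<open>k + 2\<close> there, so \<open>k\<close>
    remains after subtraction.\<close>
  define y where "y = (\<lambda>i. if i \<in> A \<and> 1 \<le> w i \<or> i \<in> B \<and> Suc k \<le> w i then 1 else 0 :: nat)"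
  define x where "x = (\<lambda>i. w i - y i)"
  have le: "y i \<le> w i" for i by (auto simp: y_def)
  have w: "Suc k \<le> w a + w b" if "a \<in> A" "b \<in> B" "adj a b" for a b
    using assms that by (auto simp: cover_exps_def covers_def)
  have sup: "w \<in> supported (A \<union> B)" using assms by (simp add: cover_exps_def)
  have "y \<in> cover_exps 1"
    using sup w by (fastforce simp: cover_exps_def covers_def supported_def y_def)
  moreover have "k \<le> x a + x b" if ab: "a \<in> A" "b \<in> B" "adj a b" for a b
  proof -
    have "a \<notin> B" "b \<notin> A" using disj ab by auto
    then show ?thesis using w[OF ab] ab by (auto simp: x_def y_def)
  qed
  then have "x \<in> cover_exps k"
    using sup by (auto simp: cover_exps_def covers_def supported_def x_def)
  moreover have "w = (\<lambda>i. x i + y i)" using le by (auto simp: x_def)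
  ultimately show ?thesis by blast
qed

text \<open>The right-hand side is the symbolic power; for bipartite graphs it agrees with the
  ordinary one, because \<open>cover_exps_Suc\<close> splits off one cover at a time.\<close>

lemma pspan_cover_exps_power:
  "(pspan (cover_exps 1) :: ('v, 'k::field) mpoly set) [^]\<^bsub>ideals_set (mpoly_ring (A \<union> B))\<^esub> k
    = pspan (cover_exps k)"
proof (induction k)
  case 0
  have "cover_exps 0 = supported (A \<union> B)" by (auto simp: cover_exps_def covers_def)
  then show ?case by (simp add: nat_pow_def ideals_set_def carrier_mpoly_ring)
next
  case (Suc k)
  have "ideal_prod (mpoly_ring (A \<union> B)) (pspan (cover_exps k)) (pspan (cover_exps 1))
      = (pspan (cover_exps (Suc k)) :: ('v, 'k) mpoly set)"
  proof (rule ideal_prod_pspan)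
    fix x y assume "x \<in> cover_exps k" "y \<in> cover_exps 1"
    then show "(\<lambda>i. x i + y i) \<in> cover_exps (Suc k)"
      by (fastforce simp: cover_exps_def covers_def supported_def)
  qed (use fin cover_exps_Suc in \<open>auto simp: cover_exps_def\<close>)
  then show ?case using Suc by (simp add: nat_pow_def ideals_set_def)
qed

lemma cover_ideal_eq:
  assumes E: "\<And>e. e \<in> E \<Longrightarrow> \<exists>a\<in>A. \<exists>b\<in>B. e = {a, b}" and adj: "\<And>a b. adj a b \<longleftrightarrow> {a, b} \<in> E"
  shows "cover_ideal (A \<union> B) E = (pspan (cover_exps 1) :: ('v, 'k::field) mpoly set)"
proof -
  have "cover_ideal (A \<union> B) E = pspan (supported (A \<union> B)) \<inter>
      (\<Inter>e\<in>E. (pspan {b \<in> supported (A \<union> B). \<exists>i\<in>e. b i \<noteq> 0} :: ('v, 'k) mpoly set))"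
    unfolding cover_ideal_def carrier_mpoly_ring using E
    by (intro arg_cong2[where f="(\<inter>)"] refl INF_cong Idl_var) blast
  also have "\<dots> = pspan (supported (A \<union> B) \<inter> {b. \<forall>e\<in>E. \<exists>i\<in>e. b i \<noteq> 0})"
    by (auto simp: pspan_def)
  also have "{b. \<forall>e\<in>E. \<exists>i\<in>e. b i \<noteq> 0} = covers 1"
  proof (rule Set.set_eqI)
    fix b :: "'v \<Rightarrow> nat"
    have "(\<forall>e\<in>E. \<exists>i\<in>e. b i \<noteq> 0) \<longleftrightarrow> (\<forall>x\<in>A. \<forall>y\<in>B. {x, y} \<in> E \<longrightarrow> b x \<noteq> 0 \<or> b y \<noteq> 0)"
    proof (intro iffI ballI impI)
      fix x y assume "\<forall>e\<in>E. \<exists>i\<in>e. b i \<noteq> 0" "{x, y} \<in> E"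
      then have "\<exists>i\<in>{x, y}. b i \<noteq> 0" by (rule bspec)
      then show "b x \<noteq> 0 \<or> b y \<noteq> 0" by simp
    next
      fix e assume *: "\<forall>x\<in>A. \<forall>y\<in>B. {x, y} \<in> E \<longrightarrow> b x \<noteq> 0 \<or> b y \<noteq> 0" and "e \<in> E"
      then obtain x y where "x \<in> A" "y \<in> B" "e = {x, y}" using E by blast
      then show "\<exists>i\<in>e. b i \<noteq> 0" using * \<open>e \<in> E\<close> by simp
    qed
    then show "b \<in> {b. \<forall>e\<in>E. \<exists>i\<in>e. b i \<noteq> 0} \<longleftrightarrow> b \<in> covers 1"
      by (simp add: covers_def adj Suc_le_eq)
  qed
  finally show ?thesis by (simp add: cover_exps_def)
qed

end

abbreviation var_power :: "nat \<Rightarrow> 'v \<Rightarrow> ('v, 'k::field) mpoly" where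
  "var_power N v \<equiv> Poly_Mapping.single (Poly_Mapping.single v N) 1"

lemma koszul_var_power:
  "finite V \<Longrightarrow> koszul V (var_power N) (pspan (supported V) :: ('v::linorder, 'k::field) mpoly set)"
proof
  show "var_power N v \<in> (pspan (supported V) :: ('v, 'k) mpoly set)" if "v \<in> V" for v
    using that by (intro pspan_singleI) (auto simp: supported_def lookup_single when_def)
qed (auto simp: pspan_0 pspan_1 pspan_add pspan_supported_mult pspan_uminus)

lemma pspan_lookup: "p \<in> pspan X \<Longrightarrow> expo t \<notin> X \<Longrightarrow> Poly_Mapping.lookup p t = 0"
  by (rule ccontr) (simp add: pspan_def flip: in_keys_iff)

section \<open>Modules presented by monomial ideals\<close>

text \<open>The ideal \<open>I\<close> and the quotient \<open>S / I\<close> are treated uniformly as the image of \<open>pspan PX\<close>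
  under a linear map \<open>\<phi>\<close> with kernel \<open>pspan NX\<close>.\<close>

locale monomial_presentation =
  fixes V :: "'v::linorder set" and PX NX :: "('v \<Rightarrow> nat) set"
    and M :: "(('v, 'k::field) mpoly, 'm) module" and \<phi> :: "('v, 'k) mpoly \<Rightarrow> 'm"
  assumes finite_V: "finite V"
    and PX: "upward_closed V PX" and NX: "upward_closed V NX" and NX_PX: "NX \<subseteq> PX"
    and abelian: "abelian_monoid M"
    and carrier: "carrier M = \<phi> ` pspan PX"
    and \<phi>_add: "p \<in> pspan PX \<Longrightarrow> q \<in> pspan PX \<Longrightarrow> \<phi> (p + q) = \<phi> p \<oplus>\<^bsub>M\<^esub> \<phi> q"
    and \<phi>_smult: "r \<in> pspan (supported V) \<Longrightarrow> p \<in> pspan PX \<Longrightarrow> \<phi> (r * p) = r \<odot>\<^bsub>M\<^esub> \<phi> p"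
    and \<phi>_kernel: "p \<in> pspan PX \<Longrightarrow> \<phi> p = \<zero>\<^bsub>M\<^esub> \<longleftrightarrow> p \<in> pspan NX"
begin

sublocale abelian_monoid M by (rule abelian)

lemma \<phi>_closed: "p \<in> pspan PX \<Longrightarrow> \<phi> p \<in> carrier M"
  by (simp add: carrier)

lemma \<phi>_0: "\<phi> 0 = \<zero>\<^bsub>M\<^esub>"
  using \<phi>_kernel[OF pspan_0] pspan_0 by blast

lemma \<phi>_eq:
  assumes "p \<in> pspan PX" "q \<in> pspan PX"
  shows "\<phi> p = \<phi> q \<longleftrightarrow> p - q \<in> pspan NX"
proof
  assume eq: "\<phi> p = \<phi> q"
  have "\<phi> (p + - q) = \<phi> (q + - q)"
    using assms eq by (simp only: \<phi>_add pspan_uminus)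
  then show "p - q \<in> pspan NX"
    using \<phi>_kernel[of "p - q"] assms by (simp add: \<phi>_0 pspan_diff)
next
  assume "p - q \<in> pspan NX"
  then have "\<phi> (p - q) = \<zero>\<^bsub>M\<^esub>" using \<phi>_kernel assms pspan_diff by blast
  moreover have "\<phi> p = \<phi> q \<oplus>\<^bsub>M\<^esub> \<phi> (p - q)"
    using \<phi>_add[of q "p - q"] assms by (simp add: pspan_diff)
  ultimately show "\<phi> p = \<phi> q" using assms \<phi>_closed by simp
qed

lemma \<phi>_sum:
  "finite D \<Longrightarrow> (\<And>d. d \<in> D \<Longrightarrow> g d \<in> pspan PX) \<Longrightarrow> (\<Oplus>\<^bsub>M\<^esub>d\<in>D. \<phi> (g d)) = \<phi> (\<Sum>d\<in>D. g d)"
proof (induction D rule: finite_induct)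
  case (insert d D)
  then show ?case
    by (subst finsum_insert) (auto simp: \<phi>_closed \<phi>_add pspan_sum)
qed (simp add: \<phi>_0)

lemma smult_carrier: "r \<in> pspan (supported V) \<Longrightarrow> m \<in> carrier M \<Longrightarrow> r \<odot>\<^bsub>M\<^esub> m \<in> carrier M"
  using pspan_upward_mult[OF PX] by (fastforce simp: carrier simp flip: \<phi>_smult)

section \<open>The upper bound for depth\<close>

lemma seq_submodule_Nil: "seq_submodule M [] = {\<zero>\<^bsub>M\<^esub>}"
  by (auto simp: seq_submodule_def)

lemma seq_submodule_closed:
  assumes "set fs \<subseteq> pspan (supported V)"
  shows "seq_submodule M fs \<subseteq> carrier M"
  using assms by (auto simp: seq_submodule_def intro!: finsum_closed smult_carrier)

text \<open>Brings the submodules of a sequence into the recursive form expected by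
  \<open>regular_sequence_bound\<close>.\<close>

lemma seq_submodule_snoc:
  assumes "set fs \<subseteq> pspan (supported V)" "f \<in> pspan (supported V)"
  shows "seq_submodule M (fs @ [f]) = {n \<oplus>\<^bsub>M\<^esub> f \<odot>\<^bsub>M\<^esub> m | n m. n \<in> seq_submodule M fs \<and> m \<in> carrier M}"
    (is "_ = ?R")
proof -
  let ?n = "length fs"
  have sum: "(\<Oplus>\<^bsub>M\<^esub>i\<in>{..<Suc ?n}. ((fs @ [f]) ! i) \<odot>\<^bsub>M\<^esub> g i)
      = (\<Oplus>\<^bsub>M\<^esub>i\<in>{..<?n}. (fs ! i) \<odot>\<^bsub>M\<^esub> g i) \<oplus>\<^bsub>M\<^esub> f \<odot>\<^bsub>M\<^esub> g ?n"
    if g: "g \<in> {..<Suc ?n} \<rightarrow> carrier M" for g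
  proof -
    have closed: "(fs ! i) \<odot>\<^bsub>M\<^esub> g i \<in> carrier M" if "i < ?n" for i
      using g that assms nth_mem[OF that] by (intro smult_carrier) (auto simp: Pi_iff)
    have last: "f \<odot>\<^bsub>M\<^esub> g ?n \<in> carrier M" using g assms by (intro smult_carrier) auto
    have "(\<Oplus>\<^bsub>M\<^esub>i\<in>{..<Suc ?n}. ((fs @ [f]) ! i) \<odot>\<^bsub>M\<^esub> g i)
        = f \<odot>\<^bsub>M\<^esub> g ?n \<oplus>\<^bsub>M\<^esub> (\<Oplus>\<^bsub>M\<^esub>i\<in>{..<?n}. ((fs @ [f]) ! i) \<odot>\<^bsub>M\<^esub> g i)"
      unfolding lessThan_Suc using closed last by (subst finsum_insert) (auto simp: nth_append)
    also have "(\<Oplus>\<^bsub>M\<^esub>i\<in>{..<?n}. ((fs @ [f]) ! i) \<odot>\<^bsub>M\<^esub> g i) = (\<Oplus>\<^bsub>M\<^esub>i\<in>{..<?n}. (fs ! i) \<odot>\<^bsub>M\<^esub> g i)"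
      using closed by (intro finsum_cong') (auto simp: nth_append)
    also have "f \<odot>\<^bsub>M\<^esub> g ?n \<oplus>\<^bsub>M\<^esub> \<dots> = \<dots> \<oplus>\<^bsub>M\<^esub> f \<odot>\<^bsub>M\<^esub> g ?n"
      using closed last by (intro a_comm finsum_closed) auto
    finally show ?thesis .
  qed
  show ?thesis
  proof
    show "seq_submodule M (fs @ [f]) \<subseteq> ?R"
    proof
      fix x assume "x \<in> seq_submodule M (fs @ [f])"
      then obtain g where g: "g \<in> {..<Suc ?n} \<rightarrow> carrier M"
        and "x = (\<Oplus>\<^bsub>M\<^esub>i\<in>{..<Suc ?n}. ((fs @ [f]) ! i) \<odot>\<^bsub>M\<^esub> g i)"
        by (auto simp: seq_submodule_def)
      then have "x = (\<Oplus>\<^bsub>M\<^esub>i\<in>{..<?n}. (fs ! i) \<odot>\<^bsub>M\<^esub> g i) \<oplus>\<^bsub>M\<^esub> f \<odot>\<^bsub>M\<^esub> g ?n"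
        using sum by simp
      moreover have "(\<Oplus>\<^bsub>M\<^esub>i\<in>{..<?n}. (fs ! i) \<odot>\<^bsub>M\<^esub> g i) \<in> seq_submodule M fs" "g ?n \<in> carrier M"
        using g by (auto simp: seq_submodule_def intro!: exI[of _ g])
      ultimately show "x \<in> ?R" by blast
    qed
    show "?R \<subseteq> seq_submodule M (fs @ [f])"
    proof clarify
      fix n m assume n: "n \<in> seq_submodule M fs" and m: "m \<in> carrier M"
      obtain g where g: "g \<in> {..<?n} \<rightarrow> carrier M" "n = (\<Oplus>\<^bsub>M\<^esub>i\<in>{..<?n}. (fs ! i) \<odot>\<^bsub>M\<^esub> g i)"
        using n by (auto simp: seq_submodule_def)
      let ?g = "g(?n := m)"
      have g': "?g \<in> {..<Suc ?n} \<rightarrow> carrier M" using g m by (auto simp: less_Suc_eq)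
      have "n = (\<Oplus>\<^bsub>M\<^esub>i\<in>{..<?n}. (fs ! i) \<odot>\<^bsub>M\<^esub> ?g i)"
        unfolding g(2) using g(1) subsetD[OF assms(1) nth_mem]
        by (intro finsum_cong') (auto intro!: smult_carrier simp: Pi_iff)
      then have "n \<oplus>\<^bsub>M\<^esub> f \<odot>\<^bsub>M\<^esub> m = (\<Oplus>\<^bsub>M\<^esub>i\<in>{..<Suc ?n}. ((fs @ [f]) ! i) \<odot>\<^bsub>M\<^esub> ?g i)"
        using sum[OF g'] by simp
      then show "n \<oplus>\<^bsub>M\<^esub> f \<odot>\<^bsub>M\<^esub> m \<in> seq_submodule M (fs @ [f])"
        using g' unfolding seq_submodule_def by (auto intro!: exI[of _ ?g])
    qed
  qed
qed

lemma max_homogeneous_ideal_eq: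
  "max_homogeneous_ideal V = (pspan {b \<in> supported V. \<exists>i\<in>V. b i \<noteq> 0} :: ('v, 'k) mpoly set)"
  unfolding max_homogeneous_ideal_def by (rule Idl_var) simp

lemma power_keys:
  assumes "f \<in> pspan X" "\<And>x. x \<in> X \<Longrightarrow> 1 \<le> (\<Sum>v\<in>V. x v)"
  shows "f ^ L \<in> pspan {x. L \<le> (\<Sum>v\<in>V. x v)}"
proof (induction L)
  case 0
  then show ?case by (simp add: pspan_def)
next
  case (Suc L)
  have "f * f ^ L \<in> pspan {x. Suc L \<le> (\<Sum>v\<in>V. x v)}"
    by (rule pspan_mult[OF assms(1) Suc]) (use assms(2) in \<open>force simp: sum.distrib\<close>)
  then show ?case by simp
qed

text \<open>Pigeonhole: a monomial of degree above \<open>card V * N\<close> has some exponent at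
  least \<open>N\<close>, hence is divisible by some x_v^N.\<close>

lemma power_in_power_ideal:
  fixes f :: "('v, 'k) mpoly"
  assumes "f \<in> max_homogeneous_ideal V"
  shows "\<exists>L g. f ^ L = (\<Sum>v\<in>V. g v * var_power N v) \<and>
    (\<forall>v\<in>V. g v \<in> pspan (supported V))"
proof -
  let ?X = "{b \<in> supported V. \<exists>i\<in>V. b i \<noteq> 0}" and ?L = "card V * N"
  have f: "f \<in> pspan ?X" using assms by (simp add: max_homogeneous_ideal_eq)
  have sup: "f ^ l \<in> pspan (supported V)" for l
  proof (induction l)
    case (Suc l)
    moreover have "f \<in> pspan (supported V)" using f pspan_mono[of ?X "supported V"] by auto
    ultimately show ?case using pspan_supported_mult by simp
  qed (simp add: pspan_1)
  define p where "p = f ^ Suc ?L"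
  have "p \<in> pspan {x. Suc ?L \<le> (\<Sum>v\<in>V. x v)}"
    unfolding p_def
  proof (rule power_keys[OF f])
    fix x assume "x \<in> ?X"
    then obtain i where "i \<in> V" "x i \<noteq> 0" by blast
    then show "1 \<le> (\<Sum>v\<in>V. x v)"
      using member_le_sum[of i V x] finite_V by (simp add: Suc_le_eq)
  qed
  have "\<exists>v\<in>V. N \<le> expo t v" if t: "t \<in> Poly_Mapping.keys p" for t
  proof (rule ccontr)
    assume "\<not> ?thesis"
    then have "(\<Sum>v\<in>V. expo t v) \<le> (\<Sum>v\<in>V. N)" by (intro sum_mono) auto
    then show False
      using t \<open>p \<in> pspan {x. Suc ?L \<le> (\<Sum>v\<in>V. x v)}\<close> by (auto simp: pspan_def)
  qed
  then obtain i where i: "\<And>t. t \<in> Poly_Mapping.keys p \<Longrightarrow> i t \<in> V \<and> N \<le> expo t (i t)"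
    by metis
  \<comment> \<open>The terms of the power are grouped by the chosen vertex \<open>i t\<close> and
    divided by its N-th power.\<close>
  define g where "g = (\<lambda>v. \<Sum>t\<in>{t \<in> Poly_Mapping.keys p. i t = v}.
    Poly_Mapping.single (t - Poly_Mapping.single v N) (Poly_Mapping.lookup p t))"
  have "g v * var_power N v = (\<Sum>t\<in>{t \<in> Poly_Mapping.keys p. i t = v}. Poly_Mapping.single t (Poly_Mapping.lookup p t))" for v
    unfolding g_def sum_distrib_right
  proof (rule sum.cong[OF refl])
    fix t assume "t \<in> {t \<in> Poly_Mapping.keys p. i t = v}"
    then have "t - Poly_Mapping.single v N + Poly_Mapping.single v N = t"
      using i[of t] by (intro poly_mapping_eqI) (auto simp: lookup_add lookup_minus lookup_single when_def)
    then show "Poly_Mapping.single (t - Poly_Mapping.single v N) (Poly_Mapping.lookup p t) * var_power N v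
        = Poly_Mapping.single t (Poly_Mapping.lookup p t)"
      by (simp add: mult_single)
  qed
  then have "(\<Sum>v\<in>V. g v * var_power N v)
      = (\<Sum>v\<in>V. \<Sum>t\<in>{t \<in> Poly_Mapping.keys p. i t = v}. Poly_Mapping.single t (Poly_Mapping.lookup p t))"
    by simp
  also have "\<dots> = (\<Sum>t\<in>Poly_Mapping.keys p. Poly_Mapping.single t (Poly_Mapping.lookup p t))"
    by (rule sum.group) (use i finite_V in auto)
  finally have "p = (\<Sum>v\<in>V. g v * var_power N v)" using sum_singles[of p] by simp
  moreover have "g v \<in> pspan (supported V)" for v
    unfolding g_def
  proof (intro pspan_sum pspan_singleI)
    fix t assume "t \<in> {t \<in> Poly_Mapping.keys p. i t = v}"
    then have "expo t \<in> supported V" using sup[of "Suc ?L"] by (auto simp: p_def pspan_def)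
    then show "expo (t - Poly_Mapping.single v N) \<in> supported V"
      by (simp add: supported_def lookup_minus)
  qed
  ultimately show ?thesis unfolding p_def by blast
qed

text \<open>Transports a regular sequence on \<open>M\<close> to submodules of the polynomial ring,
  where \<open>regular_sequence_bound\<close> applies. The given class also shows that
  \<open>M\<close> is nonzero, so the infinite value does not occur.\<close>

lemma depth_le:
  assumes z: "koszul.koszul_class V (var_power N) (pspan PX :: ('v, 'k) mpoly set) (pspan NX) j z"
  shows "depth (max_homogeneous_ideal V) M \<le> enat (card V - j)"
proof -
  interpret koszul V "var_power N" "pspan (supported V)" by (rule koszul_var_power[OF finite_V])
  have sub: "submod (pspan X)" if "upward_closed V X" for X
    using that by (auto simp: submod_def pspan_0 pspan_add pspan_upward_mult)
  have nonzero: "carrier M \<noteq> {\<zero>\<^bsub>M\<^esub>}"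
  proof
    assume "carrier M = {\<zero>\<^bsub>M\<^esub>}"
    then have "p \<in> pspan NX" if "p \<in> pspan PX" for p :: "('v, 'k) mpoly" using \<phi>_closed[OF that] \<phi>_kernel[OF that] by simp
    then have "boundary (pspan PX) (pspan NX) j z"
      using z unfolding koszul_class_def boundary_def
      by (intro exI[of _ "\<lambda>_. 0"]) (auto simp: chain_def bd_def pspan_0)
    then show False using z by (simp add: koszul_class_def)
  qed
  have "length fs \<le> card V - j"
    if fs: "set fs \<subseteq> max_homogeneous_ideal V" and reg: "regular_sequence M fs" for fs
  proof -
    have fs_S: "set fs \<subseteq> pspan (supported V)"
      using fs pspan_mono[of "{b \<in> supported V. \<exists>i\<in>V. b i \<noteq> 0}" "supported V"]
      unfolding max_homogeneous_ideal_eq by auto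
    \<comment> \<open>The preimage of (f_1, ..., f_i) M under \<open>\<phi>\<close>; it starts with
      the kernel \<open>pspan NX\<close>.\<close>
    define N' where "N' = (\<lambda>i. {p \<in> pspan PX. \<phi> p \<in> seq_submodule M (take i fs)})"
    have N'0: "N' 0 = pspan NX"
      using \<phi>_kernel pspan_mono[OF NX_PX] by (auto simp: N'_def seq_submodule_Nil)
    have step: "N' (Suc i) = {n + fs ! i * m | n m. n \<in> N' i \<and> m \<in> pspan PX}" if i: "i < length fs" for i
    proof -
      let ?f = "fs ! i" and ?s = "take i fs"
      have f: "?f \<in> pspan (supported V)" using fs_S nth_mem[OF i] by blast
      have s: "set ?s \<subseteq> pspan (supported V)" using fs_S set_take_subset[of i fs] by blast
      have seq: "seq_submodule M (take (Suc i) fs)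
          = {n \<oplus>\<^bsub>M\<^esub> ?f \<odot>\<^bsub>M\<^esub> m | n m. n \<in> seq_submodule M ?s \<and> m \<in> carrier M}"
        using seq_submodule_snoc[OF s f] i by (simp add: take_Suc_conv_app_nth)
      show ?thesis
      proof (intro Set.set_eqI iffI)
        fix p assume p: "p \<in> N' (Suc i)"
        then obtain n m where nm: "\<phi> p = n \<oplus>\<^bsub>M\<^esub> ?f \<odot>\<^bsub>M\<^esub> m" "n \<in> seq_submodule M ?s" "m \<in> carrier M"
          and pP: "p \<in> pspan PX"
          unfolding N'_def seq by blast
        then obtain n' m' where n': "n = \<phi> n'" "n' \<in> pspan PX" and m': "m = \<phi> m'" "m' \<in> pspan PX"
          using seq_submodule_closed[OF s] carrier by blast
        have fm: "?f * m' \<in> pspan PX" using pspan_upward_mult[OF PX f] m' by blast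
        have "\<phi> p = \<phi> (n' + ?f * m')"
          using nm n' m' f fm by (simp add: \<phi>_add \<phi>_smult)
        then have "p - (n' + ?f * m') \<in> pspan NX"
          using \<phi>_eq[OF pP] n' fm pspan_add by blast
        moreover have "\<phi> (p - ?f * m') = \<phi> n'"
          using calculation \<phi>_eq[of "p - ?f * m'" n'] n' pP fm
          by (simp add: pspan_diff algebra_simps)
        ultimately have "p - ?f * m' \<in> N' i"
          using nm(2) n' pP fm by (simp add: N'_def pspan_diff)
        moreover have "p = (p - ?f * m') + ?f * m'" by simp
        ultimately show "p \<in> {n + ?f * m | n m. n \<in> N' i \<and> m \<in> pspan PX}" using m' by blast
      next
        fix p assume "p \<in> {n + ?f * m | n m. n \<in> N' i \<and> m \<in> pspan PX}"
        then obtain n m where nm: "p = n + ?f * m" "n \<in> pspan PX" "\<phi> n \<in> seq_submodule M ?s" "m \<in> pspan PX"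
          by (auto simp: N'_def)
        have fm: "?f * m \<in> pspan PX" using pspan_upward_mult[OF PX f] nm by blast
        have "\<phi> p = \<phi> n \<oplus>\<^bsub>M\<^esub> ?f \<odot>\<^bsub>M\<^esub> \<phi> m" using nm f fm by (simp add: \<phi>_add \<phi>_smult)
        then show "p \<in> N' (Suc i)"
          using nm fm \<phi>_closed[of m] unfolding N'_def seq by (auto simp: pspan_add)
      qed
    qed
    have "j + length fs \<le> card V"
    proof (rule regular_sequence_bound[of "pspan PX" N' "length fs" "\<lambda>i. fs ! i"])
      show "submod (pspan PX)" "submod (N' 0)" "N' 0 \<subseteq> pspan PX"
        unfolding N'0 using sub PX NX pspan_mono[OF NX_PX] by auto
      show "koszul_class (pspan PX) (N' 0) j z" using z N'0 by simp
      show "N' (Suc i) = {n + fs ! i * m | n m. n \<in> N' i \<and> m \<in> pspan PX}" if "i < length fs" for i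
        using step that .
      show "fs ! i \<in> pspan (supported V)" if "i < length fs" for i
        using fs_S nth_mem[OF that] by blast
      show "\<exists>L g. (fs ! i) ^ L = (\<Sum>v\<in>V. g v * var_power N v) \<and> (\<forall>v\<in>V. g v \<in> pspan (supported V))"
        if "i < length fs" for i
        using power_in_power_ideal fs nth_mem[OF that] by blast
      fix i m assume i: "i < length fs" and m: "m \<in> pspan PX" "fs ! i * m \<in> N' i"
      have "fs ! i \<odot>\<^bsub>M\<^esub> \<phi> m \<in> seq_submodule M (take i fs)"
        using m \<phi>_smult[OF subsetD[OF fs_S nth_mem[OF i]] m(1)] by (simp add: N'_def)
      then have "\<phi> m \<in> seq_submodule M (take i fs)"
        using reg i m(1) \<phi>_closed unfolding regular_sequence_def by blast
      then show "m \<in> N' i" using m by (simp add: N'_def)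
    qed
    then show ?thesis by simp
  qed
  then show ?thesis
    unfolding depth_def using nonzero by (auto intro!: Sup_least)
qed

section \<open>Stanley decompositions from partitions into boxes\<close>

lemma pspan_box_eq:
  assumes u: "u \<in> supported V" and Z: "Z \<subseteq> V"
  shows "pspan (box u Z) = {v * monom u | v. v \<in> (pspan (supported Z) :: ('v, 'k) mpoly set)}"
proof -
  let ?s = "Abs_poly_mapping u"
  have s: "expo ?s = u" using expo_Abs finite_V u by blast
  show ?thesis
  proof (intro Set.set_eqI iffI)
    fix p :: "('v, 'k) mpoly" assume "p \<in> {v * monom u | v. v \<in> pspan (supported Z)}"
    then obtain v where v: "p = v * monom u" "v \<in> pspan (supported Z)" by blast
    have "monom u \<in> (pspan {u} :: ('v, 'k) mpoly set)" by (simp add: monom_def pspan_single s)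
    then show "p \<in> pspan (box u Z)"
      unfolding v(1) by (rule pspan_mult[OF v(2)]) (auto simp: supported_def box_def)
  next
    fix p :: "('v, 'k) mpoly" assume p: "p \<in> pspan (box u Z)"
    define v where "v = (\<Sum>t\<in>Poly_Mapping.keys p. Poly_Mapping.single (t - ?s) (Poly_Mapping.lookup p t))"
    have t: "t - ?s + ?s = t \<and> expo (t - ?s) \<in> supported Z" if "t \<in> Poly_Mapping.keys p" for t
    proof -
      have box: "expo t \<in> box u Z" using p that by (simp add: pspan_def)
      then have "u i \<le> expo t i" for i by (cases "i \<in> Z") (auto simp: box_def)
      then have "t - ?s + ?s = t" by (intro poly_mapping_eqI) (simp add: lookup_add lookup_minus s)
      then show ?thesis using box by (auto simp: supported_def lookup_minus s box_def)
    qed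
    have "p = v * monom u"
      unfolding v_def monom_def sum_distrib_right mult_single
      by (subst sum_singles[of p]) (use t in \<open>auto intro!: sum.cong\<close>)
    moreover have "v \<in> pspan (supported Z)"
      unfolding v_def using t by (auto intro!: pspan_sum pspan_singleI)
    ultimately show "p \<in> {v * monom u | v. v \<in> pspan (supported Z)}" by blast
  qed
qed

lemma stanley_subspace_eq:
  assumes u: "u \<in> PX" and Z: "Z \<subseteq> V"
  shows "stanley_subspace M (\<phi> (monom u)) Z = \<phi> ` pspan (box u Z)"
proof -
  have sup: "u \<in> supported V" using u PX by (auto simp: upward_closed_def)
  then have "(monom u :: ('v, 'k) mpoly) \<in> pspan PX"
    using u expo_Abs[OF finite_V] by (simp add: monom_def pspan_single)
  moreover have "pspan (supported Z) \<subseteq> pspan (supported V)"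
    using Z by (intro pspan_mono) (auto simp: supported_def)
  ultimately show ?thesis
    unfolding stanley_subspace_def pspan_box_eq[OF sup Z] carrier_mpoly_ring
    using \<phi>_smult by (auto simp: image_iff) (metis subsetD)+
qed

text \<open>The kernel of \<open>\<phi>\<close> is spanned by monomials, so the monomials with
  exponents in \<open>PX - NX\<close> stay linearly independent in \<open>M\<close>.\<close>

lemma \<phi>_pspan_inj:
  assumes "X \<subseteq> PX - NX" "p \<in> pspan X" "q \<in> pspan X" "\<phi> p = \<phi> q"
  shows "p = q"
proof -
  have "p \<in> pspan PX" "q \<in> pspan PX" using assms pspan_mono[of X PX] by auto
  then have "p - q \<in> pspan NX" using \<phi>_eq assms by blast
  moreover have "p - q \<in> pspan X" using assms pspan_diff by blast
  moreover have "X \<inter> NX = {}" using assms by auto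
  ultimately have "p - q = 0" using pspan_disjoint by blast
  then show ?thesis by simp
qed

text \<open>The single generator is a basis: uniqueness of its coefficient follows from injectivity
  of \<open>\<phi>\<close> on the box and cancellation of a monomial.\<close>

lemma free_module_box:
  assumes box: "box u Z \<subseteq> PX - NX" and Z: "Z \<subseteq> V"
  shows "free_module (mpoly_ring Z) (M\<lparr>carrier := stanley_subspace M (\<phi> (monom u)) Z\<rparr>)"
proof -
  have u: "u \<in> PX" using box box_base by blast
  have sup: "u \<in> supported V" using u PX by (auto simp: upward_closed_def)
  have box_PX: "pspan (box u Z) \<subseteq> pspan PX" using box pspan_mono[of "box u Z" PX] by auto
  \<comment> \<open>The sums in \<open>free_module\<close> are formed in the record with the smaller
    carrier, which therefore needs its own monoid laws.\<close>
  define L where "L = M\<lparr>carrier := \<phi> ` pspan (box u Z)\<rparr>"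
  have L_simps: "carrier L = \<phi> ` pspan (box u Z)" "zero L = zero M" "add L = add M" "smult L = smult M"
    by (simp_all add: L_def)
  interpret L: abelian_monoid L
  proof (rule abelian_monoidI)
    show "\<zero>\<^bsub>L\<^esub> \<in> carrier L" using \<phi>_0 pspan_0 unfolding L_simps by (metis image_eqI)
    fix x y z assume "x \<in> carrier L" "y \<in> carrier L" "z \<in> carrier L"
    then have xyz: "x \<in> carrier M" "y \<in> carrier M" "z \<in> carrier M"
      using box_PX unfolding L_simps carrier by auto
    show "x \<oplus>\<^bsub>L\<^esub> y \<oplus>\<^bsub>L\<^esub> z = x \<oplus>\<^bsub>L\<^esub> (y \<oplus>\<^bsub>L\<^esub> z)" using xyz by (simp add: L_simps a_assoc)
    show "\<zero>\<^bsub>L\<^esub> \<oplus>\<^bsub>L\<^esub> x = x" using xyz by (simp add: L_simps)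
    show "x \<oplus>\<^bsub>L\<^esub> y = y \<oplus>\<^bsub>L\<^esub> x" using xyz by (simp add: L_simps a_comm)
  next
    fix x y assume "x \<in> carrier L" "y \<in> carrier L"
    then obtain p q where "x = \<phi> p" "y = \<phi> q" "p \<in> pspan (box u Z)" "q \<in> pspan (box u Z)"
      by (auto simp: L_simps)
    moreover from this have "x \<oplus>\<^bsub>L\<^esub> y = \<phi> (p + q)"
      using \<phi>_add[OF subsetD[OF box_PX] subsetD[OF box_PX], of p q] by (simp add: L_simps)
    ultimately show "x \<oplus>\<^bsub>L\<^esub> y \<in> carrier L" by (simp add: L_simps pspan_add)
  qed
  let ?e = "\<phi> (monom u)"
  have e: "v \<odot>\<^bsub>L\<^esub> ?e = \<phi> (v * monom u)" "v * monom u \<in> pspan (box u Z)" if "v \<in> pspan (supported Z)" for v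
  proof -
    have "(monom u :: ('v, 'k) mpoly) \<in> pspan PX"
      using u sup expo_Abs[OF finite_V] by (simp add: monom_def pspan_single)
    moreover have "v \<in> pspan (supported V)"
      using that Z pspan_mono[of "supported Z" "supported V"] by (auto simp: supported_def)
    ultimately show "v \<odot>\<^bsub>L\<^esub> ?e = \<phi> (v * monom u)" by (simp add: \<phi>_smult L_simps)
    show "v * monom u \<in> pspan (box u Z)" using that by (auto simp: pspan_box_eq[OF sup Z])
  qed
  have comb: "(\<Oplus>\<^bsub>L\<^esub>b\<in>{b \<in> {?e}. c b \<noteq> \<zero>\<^bsub>mpoly_ring Z\<^esub>}. c b \<odot>\<^bsub>L\<^esub> b) = \<phi> (c ?e * monom u)"
    if "c ?e \<in> pspan (supported Z)" for c
  proof (cases "c ?e = 0")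
    case True
    then have *: "{b \<in> {?e}. c b \<noteq> \<zero>\<^bsub>mpoly_ring Z\<^esub>} = {}" by auto
    show ?thesis unfolding * using True by (simp add: L_simps \<phi>_0)
  next
    case False
    then have *: "{b \<in> {?e}. c b \<noteq> \<zero>\<^bsub>mpoly_ring Z\<^esub>} = {?e}" by auto
    have "c ?e \<odot>\<^bsub>L\<^esub> ?e \<in> carrier L" using e[OF that] by (simp add: L_simps)
    then show ?thesis unfolding * using e(1)[OF that] by simp
  qed
  have "free_module (mpoly_ring Z) L"
    unfolding free_module_def
  proof (intro exI[of _ "{?e}"] conjI ballI)
    show "{?e} \<subseteq> carrier L"
      using e(2)[OF pspan_1] by (auto simp: L_simps)
    fix m assume "m \<in> carrier L"
    then obtain v where v: "m = \<phi> (v * monom u)" "v \<in> pspan (supported Z)"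
      by (auto simp: L_simps pspan_box_eq[OF sup Z])
    show "\<exists>!c. c \<in> {?e} \<rightarrow>\<^sub>E carrier (mpoly_ring Z) \<and> finite {b \<in> {?e}. c b \<noteq> \<zero>\<^bsub>mpoly_ring Z\<^esub>} \<and>
        m = (\<Oplus>\<^bsub>L\<^esub>b\<in>{b \<in> {?e}. c b \<noteq> \<zero>\<^bsub>mpoly_ring Z\<^esub>}. c b \<odot>\<^bsub>L\<^esub> b)"
    proof (rule ex1I[of _ "\<lambda>b\<in>{?e}. v"])
      show "(\<lambda>b\<in>{?e}. v) \<in> {?e} \<rightarrow>\<^sub>E carrier (mpoly_ring Z) \<and>
          finite {b \<in> {?e}. (\<lambda>b\<in>{?e}. v) b \<noteq> \<zero>\<^bsub>mpoly_ring Z\<^esub>} \<and>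
          m = (\<Oplus>\<^bsub>L\<^esub>b\<in>{b \<in> {?e}. (\<lambda>b\<in>{?e}. v) b \<noteq> \<zero>\<^bsub>mpoly_ring Z\<^esub>}. (\<lambda>b\<in>{?e}. v) b \<odot>\<^bsub>L\<^esub> b)"
        using comb[of "\<lambda>b\<in>{?e}. v"] v by (auto simp: carrier_mpoly_ring)
    next
      fix c assume c: "c \<in> {?e} \<rightarrow>\<^sub>E carrier (mpoly_ring Z) \<and> finite {b \<in> {?e}. c b \<noteq> \<zero>\<^bsub>mpoly_ring Z\<^esub>} \<and>
        m = (\<Oplus>\<^bsub>L\<^esub>b\<in>{b \<in> {?e}. c b \<noteq> \<zero>\<^bsub>mpoly_ring Z\<^esub>}. c b \<odot>\<^bsub>L\<^esub> b)"
      then have ce: "c ?e \<in> pspan (supported Z)" by (auto simp: carrier_mpoly_ring)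
      then have "\<phi> (c ?e * monom u) = \<phi> (v * monom u)" using c comb[of c] v by simp
      then have "c ?e * monom u = v * monom u" using \<phi>_pspan_inj[OF box] e(2) ce v by blast
      then have "c ?e = v" unfolding monom_def by (rule mult_monom_inj)
      then show "c = (\<lambda>b\<in>{?e}. v)" using c by (auto intro!: ext simp: PiE_iff extensional_def)
    qed
  qed
  then show ?thesis by (simp add: L_def stanley_subspace_eq[OF u Z])
qed

text \<open>The boxes partition a K-basis of \<open>M\<close>. Components of an element are obtained
  by restricting a representative to each box; they are unique because the boxes are disjoint and
  \<open>\<phi>\<close> is injective on the span of all of them.\<close>

lemma sdepth_ge:
  assumes part: "box_union V d (PX - NX)"
    and gr: "\<And>u. u \<in> PX - NX \<Longrightarrow> \<exists>a. \<phi> (monom u) \<in> gr a"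
  shows "enat d \<le> sdepth V gr M"
proof -
  obtain F where F: "finite F" "\<forall>(u, Z)\<in>F. Z \<subseteq> V \<and> d \<le> card Z" "PX - NX = (\<Union>x\<in>F. case_prod box x)"
    and disj': "\<forall>x\<in>F. \<forall>y\<in>F. x \<noteq> y \<longrightarrow> case_prod box x \<inter> case_prod box y = {}"
    using box_union_partition[OF part] by (elim exE conjE) (rule that)
  have disj: "case_prod box x \<inter> case_prod box y = {}" if "x \<in> F" "y \<in> F" "x \<noteq> y" for x y
    using disj' that by simp
  \<comment> \<open>A decomposition is a set of pairs with first entry in \<open>M\<close>, so the
    boxes must be reindexed; injectivity ensures that no two of them are merged.\<close>
  define h where "h = (\<lambda>(u, Z). (\<phi> (monom u), Z :: 'v set))"
  have box: "box u Z \<subseteq> PX - NX" if "(u, Z) \<in> F" for u Z using F(3) that by auto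
  have inj: "inj_on h F"
  proof (rule inj_onI)
    fix x y assume xy: "x \<in> F" "y \<in> F" "h x = h y"
    obtain u Z u' Z' where x: "x = (u, Z)" and y: "y = (u', Z')" by fastforce
    have mem: "u \<in> PX - NX" "u' \<in> PX - NX" using xy box box_base unfolding x y by blast+
    then have sup: "u \<in> supported V" "u' \<in> supported V" using PX by (auto simp: upward_closed_def)
    have exp: "expo (Abs_poly_mapping u) = u" "expo (Abs_poly_mapping u') = u'"
      using expo_Abs[OF finite_V] sup by auto
    have "monom u = (monom u' :: ('v, 'k) mpoly)"
      by (rule \<phi>_pspan_inj[of "PX - NX"]) (use xy mem exp in \<open>auto simp: h_def x y monom_def pspan_single\<close>)
    then have "Poly_Mapping.keys (monom u :: ('v, 'k) mpoly) = Poly_Mapping.keys (monom u' :: ('v, 'k) mpoly)"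
      by simp
    then have "Abs_poly_mapping u = Abs_poly_mapping u'" by (simp add: monom_def)
    then have "expo (Abs_poly_mapping u) = expo (Abs_poly_mapping u')" by (rule arg_cong)
    then have "u = u'" unfolding exp .
    then show "x = y" using xy by (simp add: h_def x y)
  qed
  define D where "D = h ` F"
  define r where "r = the_inv_into F h"
  define X where "X = (\<lambda>d. case_prod box (r d))"
  have r: "r d \<in> F" "h (r d) = d" if "d \<in> D" for d
    using that inj by (auto simp: D_def r_def the_inv_into_f_f)
  have r_h: "r (h x) = x" if "x \<in> F" for x using inj that by (simp add: r_def the_inv_into_f_f)
  have finD: "finite D" using F by (simp add: D_def)
  have X_sub: "X d \<subseteq> PX - NX" if "d \<in> D" for d
    using r(1)[OF that] F(3) by (auto simp: X_def)
  have X_disj: "X d \<inter> X d' = {}" if "d \<in> D" "d' \<in> D" "d \<noteq> d'" for d d'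
    using disj[of "r d" "r d'"] r that unfolding X_def by metis
  have X_Un: "PX - NX = (\<Union>d\<in>D. X d)"
    unfolding F(3) D_def X_def using r_h by auto
  have subspace: "(case d of (m, Z) \<Rightarrow> stanley_subspace M m Z) = \<phi> ` pspan (X d)" if d: "d \<in> D" for d
  proof -
    obtain u Z where uZ: "r d = (u, Z)" by fastforce
    then have uZF: "(u, Z) \<in> F" and "d = (\<phi> (monom u), Z)" using r[OF d] by (auto simp: h_def)
    moreover have "u \<in> PX" "Z \<subseteq> V" using box[OF uZF] box_base F(2) uZF by auto
    moreover have "X d = box u Z" by (simp add: X_def uZ)
    ultimately show ?thesis by (simp add: stanley_subspace_eq)
  qed
  have X_PX: "pspan (X d) \<subseteq> pspan PX" if "d \<in> D" for d
    using X_sub[OF that] by (intro pspan_mono) blast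
  have "stanley_decomposition V gr M D"
    unfolding stanley_decomposition_def
  proof (intro conjI ballI finD)
    fix d assume "d \<in> D"
    then obtain u Z where uZ: "(u, Z) \<in> F" "d = (\<phi> (monom u), Z)" by (auto simp: D_def h_def)
    have u: "u \<in> PX - NX" using box[OF uZ(1)] box_base by blast
    then have "u \<in> supported V" using PX by (auto simp: upward_closed_def)
    then have "(monom u :: ('v, 'k) mpoly) \<in> pspan PX" using expo_Abs[OF finite_V] u by (simp add: monom_def pspan_single)
    moreover have "Z \<subseteq> V" using F(2) uZ by auto
    ultimately show "case d of (m, Z) \<Rightarrow> stanley_space V gr M m Z"
      using gr[OF u] free_module_box[OF box[OF uZ(1)]] by (simp add: stanley_space_def uZ \<phi>_closed)
  next
    fix m assume "m \<in> carrier M"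
    then obtain p where p: "m = \<phi> p" "p \<in> pspan PX" by (auto simp: carrier)
    let ?S = "\<Pi>\<^sub>E (m, Z)\<in>D. stanley_subspace M m Z"
    show "\<exists>!f. f \<in> ?S \<and> m = (\<Oplus>\<^bsub>M\<^esub>d\<in>D. f d)"
    proof (rule ex_ex1I)
      have restr: "\<phi> (restr (X d) p) \<in> (case d of (m, Z) \<Rightarrow> stanley_subspace M m Z)" if "d \<in> D" for d
        unfolding subspace[OF that] by (intro imageI restr_mem)
      have restr_PX: "restr (X d) p \<in> pspan PX" if "d \<in> D" for d
        using X_PX[OF that] restr_mem by (rule subsetD)
      have "(\<Oplus>\<^bsub>M\<^esub>d\<in>D. (\<lambda>d\<in>D. \<phi> (restr (X d) p)) d) = (\<Oplus>\<^bsub>M\<^esub>d\<in>D. \<phi> (restr (X d) p))"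
        by (intro finsum_cong') (auto intro!: \<phi>_closed restr_PX)
      also have "\<dots> = \<phi> (\<Sum>d\<in>D. restr (X d) p)"
        by (intro \<phi>_sum finD restr_PX)
      also have "(\<Sum>d\<in>D. restr (X d) p) = restr (PX - NX) p"
      proof (rule poly_mapping_eqI)
        fix t
        show "Poly_Mapping.lookup (\<Sum>d\<in>D. restr (X d) p) t = Poly_Mapping.lookup (restr (PX - NX) p) t"
        proof (cases "expo t \<in> PX - NX")
          case True
          then obtain d where d: "d \<in> D" "expo t \<in> X d" using X_Un by auto
          have "expo t \<notin> X d'" if "d' \<in> D" "d' \<noteq> d" for d'
            using X_disj[OF that(1) d(1) that(2)] d(2) by blast
          then have "Poly_Mapping.lookup (\<Sum>d\<in>D. restr (X d) p) t
              = (\<Sum>d'\<in>D. if d' = d then Poly_Mapping.lookup p t else 0)"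
            unfolding lookup_sum lookup_restr using d(2) by (intro sum.cong) (simp_all del: split_paired_All)
          then show ?thesis using True d finD by (simp add: lookup_restr)
        next
          case False
          then show ?thesis using X_Un by (auto simp: lookup_sum lookup_restr intro!: sum.neutral)
        qed
      qed
      \<comment> \<open>The discarded monomials have exponents in \<open>NX\<close> and are killed
        by \<open>\<phi>\<close>.\<close>
      also have "\<phi> (restr (PX - NX) p) = \<phi> p"
      proof -
        have "restr (PX - NX) p \<in> pspan PX" using restr_mem pspan_mono[of "PX - NX" PX] by blast
        moreover have "restr (PX - NX) p - p \<in> pspan NX"
          using p(2) by (auto simp: pspan_def in_keys_iff lookup_minus lookup_restr split: if_splits)
        ultimately show ?thesis using \<phi>_eq p by blast
      qed
      finally show "\<exists>f. f \<in> ?S \<and> m = (\<Oplus>\<^bsub>M\<^esub>d\<in>D. f d)"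
        using restr p by (intro exI[of _ "\<lambda>d\<in>D. \<phi> (restr (X d) p)"]) auto
    next
      fix f f' assume f: "f \<in> ?S \<and> m = (\<Oplus>\<^bsub>M\<^esub>d\<in>D. f d)" and f': "f' \<in> ?S \<and> m = (\<Oplus>\<^bsub>M\<^esub>d\<in>D. f' d)"
      have lift: "\<exists>g. \<forall>d\<in>D. f d = \<phi> (g d) \<and> g d \<in> pspan (X d)" if f: "f \<in> ?S" for f
      proof -
        have "f d \<in> \<phi> ` pspan (X d)" if "d \<in> D" for d using PiE_mem[OF f that] subspace[OF that] by simp
        then have "\<forall>d\<in>D. \<exists>q. f d = \<phi> q \<and> q \<in> pspan (X d)" by blast
        then show ?thesis by (rule bchoice)
      qed
      obtain g where g: "\<And>d. d \<in> D \<Longrightarrow> f d = \<phi> (g d)" "\<And>d. d \<in> D \<Longrightarrow> g d \<in> pspan (X d)"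
        using lift f by metis
      obtain g' where g': "\<And>d. d \<in> D \<Longrightarrow> f' d = \<phi> (g' d)" "\<And>d. d \<in> D \<Longrightarrow> g' d \<in> pspan (X d)"
        using lift f' by metis
      have sum: "m = \<phi> (\<Sum>d\<in>D. g d)" if "m = (\<Oplus>\<^bsub>M\<^esub>d\<in>D. f d)" "\<And>d. d \<in> D \<Longrightarrow> f d = \<phi> (g d)"
        "\<And>d. d \<in> D \<Longrightarrow> g d \<in> pspan (X d)" for f g
      proof -
        have "m = (\<Oplus>\<^bsub>M\<^esub>d\<in>D. \<phi> (g d))"
          unfolding that(1) using that(2) subsetD[OF X_PX that(3)]
          by (intro finsum_cong') (auto intro!: \<phi>_closed)
        also have "\<dots> = \<phi> (\<Sum>d\<in>D. g d)" using that(3) X_PX by (intro \<phi>_sum finD) blast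
        finally show ?thesis .
      qed
      have PNX: "pspan (X d) \<subseteq> pspan (PX - NX)" if "d \<in> D" for d using X_sub[OF that] by (rule pspan_mono)
      have eq: "(\<Sum>d\<in>D. g d) = (\<Sum>d\<in>D. g' d)"
      proof (rule \<phi>_pspan_inj[OF order_refl])
        show "(\<Sum>d\<in>D. g d) \<in> pspan (PX - NX)" using g(2) PNX by (intro pspan_sum) blast
        show "(\<Sum>d\<in>D. g' d) \<in> pspan (PX - NX)" using g'(2) PNX by (intro pspan_sum) blast
        show "\<phi> (\<Sum>d\<in>D. g d) = \<phi> (\<Sum>d\<in>D. g' d)" using sum[of f g] sum[of f' g'] f f' g g' by simp
      qed
      have lookup: "Poly_Mapping.lookup (\<Sum>d\<in>D. g d) t = Poly_Mapping.lookup (g d) t"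
        if "\<And>d. d \<in> D \<Longrightarrow> g d \<in> pspan (X d)" "d \<in> D" "expo t \<in> X d" for g d t
      proof -
        have "Poly_Mapping.lookup (g d') t = 0" if "d' \<in> D" "d' \<noteq> d" for d'
        proof -
          have "expo t \<notin> X d'" using X_disj[of d' d] that \<open>d \<in> D\<close> \<open>expo t \<in> X d\<close> by blast
          then show ?thesis
            using \<open>\<And>d. d \<in> D \<Longrightarrow> g d \<in> pspan (X d)\<close>[OF that(1)] by (intro pspan_lookup)
        qed
        then have "Poly_Mapping.lookup (\<Sum>d\<in>D. g d) t
            = (\<Sum>d'\<in>D. if d' = d then Poly_Mapping.lookup (g d) t else 0)"
          unfolding lookup_sum by (intro sum.cong) auto
        then show ?thesis using finD that(2) by simp
      qed
      have "g d = g' d" if d: "d \<in> D" for d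
      proof (rule poly_mapping_eqI)
        fix t
        show "Poly_Mapping.lookup (g d) t = Poly_Mapping.lookup (g' d) t"
        proof (cases "expo t \<in> X d")
          case True
          then show ?thesis using lookup[of g d t] lookup[of g' d t] g(2) g'(2) d eq by simp
        next
          case False
          then show ?thesis using pspan_lookup[OF g(2)[OF d]] pspan_lookup[OF g'(2)[OF d]] by simp
        qed
      qed
      then have "f d = f' d" if "d \<in> D" for d using g(1) g'(1) that by simp
      then show "f = f'" using f f' by (intro PiE_ext[of f D _ f']) auto
    qed
  qed
  moreover have "enat d \<le> decomposition_sdepth D"
    unfolding decomposition_sdepth_def D_def using F(2) by (auto simp: h_def intro!: INF_greatest)
  ultimately show ?thesis
    unfolding sdepth_def by (intro Sup_upper2[of "decomposition_sdepth D"]) auto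
qed

end

section \<open>A nonzero Koszul class\<close>

context koszul
begin

text \<open>The cycle \<open>c \<and>\<^sub>i (y\<^bsub>p\<^esub> e\<^bsub>q\<^esub> - y\<^bsub>q\<^esub> e\<^bsub>p\<^esub>)\<close>, over the pairs \<open>(p, q)\<close> of a matching: the fundamental cycle
  of a cross-polytope.\<close>

primrec cross_cycle :: "'a \<Rightarrow> ('i \<times> 'i) list \<Rightarrow> 'i set \<Rightarrow> 'a" where
  "cross_cycle c [] = (\<lambda>\<sigma>. if \<sigma> = {} then c else 0)"
| "cross_cycle c (e # ps) = (\<lambda>\<sigma>. y (fst e) * wedge (snd e) (cross_cycle c ps) \<sigma>
    - y (snd e) * wedge (fst e) (cross_cycle c ps) \<sigma>)"

definition verts :: "('i \<times> 'i) list \<Rightarrow> 'i set" where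
  "verts ps = fst ` set ps \<union> snd ` set ps"

lemma finite_verts [simp]: "finite (verts ps)"
  by (simp add: verts_def)

lemma verts_Cons: "verts (e # ps) = insert (fst e) (insert (snd e) (verts ps))"
  by (auto simp: verts_def)

text \<open>By the Leibniz rule both summands of a factor contribute \<open>y p * y q\<close> times
  the remaining cycle, with opposite signs.\<close>

lemma bd_cross_cycle:
  assumes "verts ps \<subseteq> V" "finite \<sigma>"
  shows "bd (cross_cycle c ps) \<sigma> = 0"
  using assms
proof (induction ps arbitrary: \<sigma>)
  case Nil
  then show ?case by (simp add: bd_def)
next
  case (Cons e ps)
  then have "bd (cross_cycle c ps) \<tau> = 0" if "finite \<tau>" for \<tau>
    using that by (simp add: verts_Cons)
  then have "wedge i (bd (cross_cycle c ps)) \<sigma> = 0" for i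
    using Cons.prems by (simp add: wedge_def)
  then show ?case
    using Cons.prems by (simp add: bd_diff bd_scale bd_wedge verts_Cons mult.left_commute)
qed

text \<open>Over the whole ring the cross-polytope cycle bounds. The bounding chain represents the
  class for the quotient by the ideal.\<close>

lemma bd_wedge_wedge_cross_cycle:
  assumes "verts (e # ps) \<subseteq> V" "finite \<sigma>"
  shows "bd (wedge (fst e) (wedge (snd e) (cross_cycle c ps))) \<sigma> = cross_cycle c (e # ps) \<sigma>"
proof -
  have V: "fst e \<in> V" "snd e \<in> V" "verts ps \<subseteq> V" using assms by (auto simp: verts_Cons)
  have "bd (wedge (snd e) (cross_cycle c ps)) \<tau> = y (snd e) * cross_cycle c ps \<tau>" if "finite \<tau>" for \<tau>
  proof -
    have "wedge (snd e) (bd (cross_cycle c ps)) \<tau> = 0"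
      using bd_cross_cycle[OF V(3)] that by (simp add: wedge_def)
    then show ?thesis using V that by (simp add: bd_wedge)
  qed
  then have "wedge (fst e) (bd (wedge (snd e) (cross_cycle c ps))) \<sigma>
      = y (snd e) * wedge (fst e) (cross_cycle c ps) \<sigma>"
    using assms(2) by (simp add: wedge_def mult.left_commute)
  then show ?thesis using V assms(2) by (simp add: bd_wedge)
qed

lemma chain_diff:
  assumes "submod M" "chain M j z" "chain M j w"
  shows "chain M j (\<lambda>\<sigma>. z \<sigma> - w \<sigma>)"
  unfolding chain_def
proof (intro conjI allI)
  fix \<sigma>
  show "z \<sigma> - w \<sigma> \<in> M" using assms by (simp add: chain_def submod_diff)
  show "\<sigma> \<subseteq> V \<and> card \<sigma> = j \<or> z \<sigma> - w \<sigma> = 0"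
    using chain_outside[OF assms(2), of \<sigma>] chain_outside[OF assms(3), of \<sigma>]
    by (cases "\<sigma> \<subseteq> V \<and> card \<sigma> = j") simp_all
qed

lemma chain_cross_cycle:
  assumes "verts ps \<subseteq> V" "c \<in> R"
  shows "chain R (length ps) (cross_cycle c ps)"
  using assms
proof (induction ps)
  case Nil
  then show ?case by (simp add: chain_def zero_R)
next
  case (Cons e ps)
  then have IH: "chain R (length ps) (cross_cycle c ps)" and e: "fst e \<in> V" "snd e \<in> V"
    by (simp_all add: verts_Cons)
  have R: "submod R" by (simp add: submod_def zero_R add_R mult_R)
  have w: "chain R (Suc (length ps)) (\<lambda>\<sigma>. r * wedge i (cross_cycle c ps) \<sigma>)" if "i \<in> V" "r \<in> R" for i r
    using chain_scale[OF R that(2) chain_wedge[OF R IH that(1)]] .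
  show ?case
    using w[OF e(2) y_R[OF e(1)]] w[OF e(1) y_R[OF e(2)]] R
    by (simp add: chain_diff)
qed

text \<open>The support consists of faces of the cross-polytope, and the coefficient is up to sign
  the product over the opposite vertices. This decides whether it lies in J^k.\<close>

lemma cross_cycle_values:
  assumes "distinct (map fst ps @ map snd ps)" "cross_cycle c ps \<sigma> \<noteq> 0"
  shows "\<sigma> \<subseteq> verts ps \<and> (\<forall>(p, q)\<in>set ps. p \<notin> \<sigma> \<or> q \<notin> \<sigma>) \<and>
    (\<exists>\<epsilon>\<in>{1, -1}. cross_cycle c ps \<sigma> = \<epsilon> * ((\<Prod>v\<in>verts ps - \<sigma>. y v) * c))"
  using assms
proof (induction ps arbitrary: \<sigma>)
  case Nil
  then show ?case by (auto simp: verts_def split: if_splits)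
next
  case (Cons e ps)
  obtain p q where e: "e = (p, q)" by fastforce
  have new: "p \<noteq> q" "p \<notin> verts ps" "q \<notin> verts ps" and dist: "distinct (map fst ps @ map snd ps)"
    using Cons.prems(1) by (auto simp: verts_def e)
  note IH = Cons.IH[OF dist]
  \<comment> \<open>\<open>i\<close> is the end of the first pair that lies in
    \<open>\<sigma>\<close> and \<open>j\<close> the other one; \<open>\<delta>\<close> is the sign
    of the corresponding summand.\<close>
  have main: ?case if i: "i \<in> \<sigma>" "j \<notin> \<sigma>" and ij: "{i, j} = {p, q}"
    and val: "cross_cycle c (e # ps) \<sigma> = \<delta> * y j * (koszul_sign i \<sigma> * cross_cycle c ps (\<sigma> - {i}))"
    and \<delta>: "\<delta> \<in> {1, -1}" for i j \<delta>
  proof -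
    have nz: "cross_cycle c ps (\<sigma> - {i}) \<noteq> 0" using Cons.prems(2) val by auto
    obtain \<epsilon> where \<epsilon>: "\<epsilon> \<in> {1, -1}"
      "cross_cycle c ps (\<sigma> - {i}) = \<epsilon> * ((\<Prod>v\<in>verts ps - (\<sigma> - {i}). y v) * c)"
      using IH[OF nz] by blast
    have sub: "\<sigma> - {i} \<subseteq> verts ps" and tr: "\<forall>(p, q)\<in>set ps. p \<notin> \<sigma> - {i} \<or> q \<notin> \<sigma> - {i}"
      using IH[OF nz] by auto
    have ni: "i \<notin> verts ps" "j \<notin> verts ps" using ij new by (auto simp: doubleton_eq_iff)
    have V: "verts (e # ps) = insert i (insert j (verts ps))" using ij by (auto simp: verts_Cons e doubleton_eq_iff)
    have "verts (e # ps) - \<sigma> = insert j (verts ps - (\<sigma> - {i}))" using V i ni by auto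
    then have "(\<Prod>v\<in>verts (e # ps) - \<sigma>. y v) = y j * (\<Prod>v\<in>verts ps - (\<sigma> - {i}). y v)"
      using ni by simp
    then have "cross_cycle c (e # ps) \<sigma>
        = (\<delta> * koszul_sign i \<sigma> * \<epsilon>) * ((\<Prod>v\<in>verts (e # ps) - \<sigma>. y v) * c)"
      unfolding val \<epsilon>(2) by (simp only: ac_simps)
    moreover have "\<delta> * koszul_sign i \<sigma> * \<epsilon> \<in> {1, -1}"
      using \<delta> \<epsilon>(1) koszul_sign_cases[of i \<sigma>, where 'a = 'a] by auto
    moreover have "\<sigma> \<subseteq> verts (e # ps)" using sub V by auto
    moreover have "a \<notin> \<sigma> \<or> b \<notin> \<sigma>" if "(a, b) \<in> set (e # ps)" for a b
    proof (cases "(a, b) = e")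
      case True
      then show ?thesis using i ij by (auto simp: e doubleton_eq_iff)
    next
      case False
      then have "(a, b) \<in> set ps" using that by simp
      then have "a \<notin> \<sigma> - {i} \<or> b \<notin> \<sigma> - {i}" "a \<noteq> i" "b \<noteq> i"
        using tr ni by (force simp: verts_def)+
      then show ?thesis by blast
    qed
    ultimately show ?thesis by blast
  qed
  consider "p \<in> \<sigma>" "q \<in> \<sigma>" | "p \<notin> \<sigma>" "q \<notin> \<sigma>" | "p \<in> \<sigma>" "q \<notin> \<sigma>" | "p \<notin> \<sigma>" "q \<in> \<sigma>" by blast
  then show ?case
  proof cases
    case 1
    have "cross_cycle c ps (\<sigma> - {q}) = 0" using IH[of "\<sigma> - {q}"] 1 new by blast
    moreover have "cross_cycle c ps (\<sigma> - {p}) = 0" using IH[of "\<sigma> - {p}"] 1 new by blast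
    ultimately have "cross_cycle c (e # ps) \<sigma> = 0" by (simp add: wedge_def e)
    then show ?thesis using Cons.prems(2) by contradiction
  next
    case 2
    then have "cross_cycle c (e # ps) \<sigma> = 0" by (simp add: wedge_def e)
    then show ?thesis using Cons.prems(2) by contradiction
  next
    case 3
    then show ?thesis by (intro main[of p q "-1"]) (auto simp: wedge_def e)
  next
    case 4
    then show ?thesis by (intro main[of q p 1]) (auto simp: wedge_def e)
  qed
qed

text \<open>One facet with a coefficient known to be a unit multiple of a product, on which
  nonvanishing is tested.\<close>

lemma cross_cycle_facet:
  assumes "distinct (map fst ps @ map snd ps)"
  shows "\<exists>\<epsilon>\<in>{1, -1}. cross_cycle c ps (snd ` set ps) = \<epsilon> * ((\<Prod>v\<in>fst ` set ps. y v) * c)"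
  using assms
proof (induction ps)
  case (Cons e ps)
  obtain p q where e: "e = (p, q)" by fastforce
  have new: "p \<noteq> q" "p \<notin> verts ps" "q \<notin> verts ps" and dist: "distinct (map fst ps @ map snd ps)"
    using Cons.prems(1) by (auto simp: verts_def e)
  obtain \<epsilon> where \<epsilon>: "\<epsilon> \<in> {1, -1}" "cross_cycle c ps (snd ` set ps) = \<epsilon> * ((\<Prod>v\<in>fst ` set ps. y v) * c)"
    using Cons.IH[OF dist] by blast
  let ?\<sigma> = "snd ` set (e # ps)"
  have "p \<notin> ?\<sigma>" "?\<sigma> - {q} = snd ` set ps" "q \<in> ?\<sigma>" using new by (auto simp: e verts_def)
  then have "cross_cycle c (e # ps) ?\<sigma> = y p * (koszul_sign q ?\<sigma> * cross_cycle c ps (snd ` set ps))"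
    by (simp add: wedge_def e)
  also have "\<dots> = (koszul_sign q ?\<sigma> * \<epsilon>) * ((y p * (\<Prod>v\<in>fst ` set ps. y v)) * c)"
    unfolding \<epsilon>(2) by (simp only: ac_simps)
  also have "y p * (\<Prod>v\<in>fst ` set ps. y v) = (\<Prod>v\<in>fst ` set (e # ps). y v)"
    using new by (simp add: e verts_def)
  finally have "cross_cycle c (e # ps) ?\<sigma> = (koszul_sign q ?\<sigma> * \<epsilon>) * ((\<Prod>v\<in>fst ` set (e # ps). y v) * c)" .
  moreover have "koszul_sign q ?\<sigma> * \<epsilon> \<in> {1, -1}"
    using \<epsilon>(1) koszul_sign_cases[of q ?\<sigma>, where 'a = 'a] by auto
  ultimately show ?case by blast
qed simp

end

lemma prod_var_power:
  "finite T \<Longrightarrow> (\<Prod>v\<in>T. var_power N v) = Poly_Mapping.single (\<Sum>v\<in>T. Poly_Mapping.single v N) (1 :: 'k::field)"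
  by (induction T rule: finite_induct) (simp_all add: mult_single)

lemma expo_sum_single: "finite T \<Longrightarrow> expo (\<Sum>v\<in>T. Poly_Mapping.single v N) i = (if i \<in> T then N else 0)"
  by (simp add: lookup_sum lookup_single when_def)

section \<open>Exponents attached to an ordered matching\<close>

context bipartition
begin

text \<open>With these exponents the matching edges \<open>{p, q}\<close> are the only ones with
  \<open>b\<^sub>p + b\<^sub>q < k\<close>.\<close>

primrec base_exps :: "nat \<Rightarrow> ('v \<times> 'v) list \<Rightarrow> 'v \<Rightarrow> nat" where
  "base_exps k [] = (\<lambda>i. if i \<in> A \<union> B then k else 0)"
| "base_exps k (e # ps) = (base_exps k ps)(fst e := k - Suc (length ps), snd e := length ps)"

lemma ordered_matching_distinct:
  assumes "ordered_matching ps"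
  shows "distinct (map fst ps @ map snd ps)"
proof -
  have "distinct (map fst ps)" "distinct (map snd ps)" "set (map fst ps) \<subseteq> A" "set (map snd ps) \<subseteq> B"
    using assms by (induction ps) auto
  then show ?thesis using disj by auto
qed

lemma base_exps_unmatched: "i \<notin> fst ` set ps \<Longrightarrow> i \<notin> snd ` set ps \<Longrightarrow> base_exps k ps i = (if i \<in> A \<union> B then k else 0)"
  by (induction ps) auto

lemma base_exps_supported: "ordered_matching ps \<Longrightarrow> base_exps k ps \<in> supported (A \<union> B)"
  by (induction ps) (auto simp: supported_def)

text \<open>A pair followed by m others carries k - 1 - m and m, with sum k - 1. The bound on
  \<open>length ps\<close> keeps the subtraction from being truncated.\<close>

lemma base_exps_matched:
  assumes "ordered_matching ps" "length ps \<le> k" "(p, q) \<in> set ps"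
  shows "base_exps k ps p + base_exps k ps q < k"
  using assms
proof (induction ps)
  case (Cons e ps)
  show ?case
  proof (cases "(p, q) = e")
    case True
    then have "p \<noteq> q" using Cons.prems disj by auto
    then show ?thesis using True[symmetric] Cons.prems(2) by auto
  next
    case False
    then have pq: "(p, q) \<in> set ps" using Cons.prems by simp
    then have "p \<in> A" "q \<in> B" using ordered_matching_mem[of ps p q] Cons.prems by auto
    moreover have "p \<in> fst ` set ps" "q \<in> snd ` set ps"
      using imageI[OF pq, of fst] imageI[OF pq, of snd] by simp_all
    moreover have "fst e \<in> A" "snd e \<in> B" "fst e \<notin> fst ` set ps" "snd e \<notin> snd ` set ps"
      using Cons.prems(1) by simp_all
    ultimately have "p \<noteq> fst e" "p \<noteq> snd e" "q \<noteq> fst e" "q \<noteq> snd e" using disj by blast+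
    then show ?thesis using Cons pq by simp
  qed
qed simp

lemma base_exps_fst_ge:
  "ordered_matching ps \<Longrightarrow> p \<in> A \<Longrightarrow> k - length ps \<le> base_exps k ps p"
  using disj by (induction ps) (auto simp: diff_le_mono2 intro: le_trans)

text \<open>An unmatched end alone contributes \<open>k\<close>. If both ends are matched, the order
  forces the pair of \<open>w\<close> to precede that of \<open>a\<close>; with m and m' pairs
  behind them, m > m', the sum is m + (k - 1 - m') >= k.\<close>

lemma base_exps_unmatched_edge:
  assumes "ordered_matching ps" "length ps \<le> k" "a \<in> A" "w \<in> B" "adj a w" "(a, w) \<notin> set ps"
  shows "k \<le> base_exps k ps a + base_exps k ps w"
  using assms
proof (induction ps)
  case (Cons e ps)
  obtain p q where e: "e = (p, q)" by fastforce
  have om: "ordered_matching ps" "p \<in> A" "q \<in> B" and len: "Suc (length ps) \<le> k"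
    and nadj: "\<forall>q'\<in>snd ` set ps. \<not> adj p q'"
    using Cons.prems by (auto simp: e)
  have ne: "a \<noteq> q" "w \<noteq> p" using Cons.prems om disj by auto
  have fst_A: "fst ` set ps \<subseteq> A" using ordered_matching_mem[OF om(1)] by force
  show ?case
  proof (cases "a = p")
    case True
    then have "w \<noteq> q" using Cons.prems by (auto simp: e)
    moreover have "w \<notin> snd ` set ps" "w \<notin> fst ` set ps"
      using nadj True Cons.prems fst_A disj by auto
    ultimately show ?thesis using ne Cons.prems(4) by (simp add: e base_exps_unmatched)
  next
    case a: False
    show ?thesis
    proof (cases "w = q")
      case True
      \<comment> \<open>The missing \<open>length ps\<close> is exactly the exponent of
        \<open>q\<close>.\<close>
      have "k - length ps \<le> base_exps k ps a" using base_exps_fst_ge om Cons.prems by blast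
      then show ?thesis using True a ne by (simp add: e)
    next
      case False
      then have "k \<le> base_exps k ps a + base_exps k ps w" using Cons by (auto simp: e)
      then show ?thesis using False a ne by (simp add: e)
    qed
  qed
qed (auto)

end

text \<open>The \<open>itself\<close> parameter makes the coefficient field a parameter of the
  locale, as no assumption mentions it.\<close>

locale matched_bipartition = bipartition A B adj
    for A B :: "'v::linorder set" and adj :: "'v \<Rightarrow> 'v \<Rightarrow> bool" +
  fixes ps :: "('v \<times> 'v) list" and k :: nat and field_type :: "'k::field itself"
  assumes om: "ordered_matching ps" and len: "length ps \<le> k"
begin

definition b where "b = base_exps k ps"

text \<open>The exponent \<open>Suc k\<close> is large enough to satisfy every edge at a vertex on
  its own, and exceeds the exponent \<open>k\<close> of unmatched vertices.\<close>

sublocale koszul "A \<union> B" "var_power (Suc k)" "pspan (supported (A \<union> B)) :: ('v, 'k) mpoly set"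
  using fin by (intro koszul_var_power) simp

abbreviation cycle :: "('v \<times> 'v) list \<Rightarrow> 'v set \<Rightarrow> ('v, 'k) mpoly" where
  "cycle \<equiv> cross_cycle (monom b)"

lemma b_supported: "b \<in> supported (A \<union> B)"
  unfolding b_def by (rule base_exps_supported[OF om])

lemma expo_b: "expo (Abs_poly_mapping b) = b"
  using expo_Abs[of "A \<union> B"] fin b_supported by simp

lemma verts_V: "verts ps \<subseteq> A \<union> B"
  using ordered_matching_mem[OF om] by (force simp: verts_def)

lemma monom_b_mem: "monom b \<in> (pspan (supported (A \<union> B)) :: ('v, 'k) mpoly set)"
  using b_supported by (simp add: monom_def pspan_single expo_b)

lemma prod_monom_b:
  assumes "finite T"
  shows "(\<Prod>v\<in>T. var_power (Suc k) v) * monom b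
    = (Poly_Mapping.single ((\<Sum>v\<in>T. Poly_Mapping.single v (Suc k)) + Abs_poly_mapping b) 1 :: ('v, 'k) mpoly)"
  using assms by (simp add: prod_var_power monom_def mult_single)

text \<open>A face omits an end of every matching edge, and the power of that end in the coefficient
  repairs the edge; all other edges hold already for \<open>b\<close>.\<close>

lemma cycle_mem: "cycle ps \<sigma> \<in> pspan (cover_exps k)"
proof (cases "cycle ps \<sigma> = 0")
  case False
  then have tr: "\<forall>(p, q)\<in>set ps. p \<notin> \<sigma> \<or> q \<notin> \<sigma>"
    and "\<exists>\<epsilon>\<in>{1, -1}. cycle ps \<sigma> = \<epsilon> * ((\<Prod>v\<in>verts ps - \<sigma>. var_power (Suc k) v) * monom b)"
    using cross_cycle_values[OF ordered_matching_distinct[OF om] False] by blast+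
  then obtain \<epsilon> where \<epsilon>: "\<epsilon> \<in> {1, -1}"
    "cycle ps \<sigma> = \<epsilon> * ((\<Prod>v\<in>verts ps - \<sigma>. var_power (Suc k) v) * monom b)"
    by blast
  let ?t = "(\<Sum>v\<in>verts ps - \<sigma>. Poly_Mapping.single v (Suc k)) + Abs_poly_mapping b"
  have t: "expo ?t i = (if i \<in> verts ps - \<sigma> then Suc k else 0) + b i" for i
    using expo_sum_single[of "verts ps - \<sigma>" "Suc k" i] by (simp add: lookup_add expo_b)
  have "expo ?t \<in> cover_exps k"
    unfolding cover_exps_def covers_def
  proof (intro IntI CollectI ballI impI)
    show "expo ?t \<in> supported (A \<union> B)"
      using verts_V b_supported by (auto simp: supported_def t)
    fix a w assume aw: "a \<in> A" "w \<in> B" "adj a w"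
    show "k \<le> expo ?t a + expo ?t w"
    proof (cases "(a, w) \<in> set ps")
      case True
      then have "a \<in> verts ps - \<sigma> \<or> w \<in> verts ps - \<sigma>" using tr by (force simp: verts_def)
      then show ?thesis by (auto simp: t)
    next
      case False
      then have "k \<le> b a + b w" using base_exps_unmatched_edge om len aw by (simp add: b_def)
      then show ?thesis by (simp add: t)
    qed
  qed
  then have "(Poly_Mapping.single ?t 1 :: ('v, 'k) mpoly) \<in> pspan (cover_exps k)" by (rule pspan_singleI)
  then show ?thesis
    unfolding \<epsilon>(2) prod_monom_b[OF finite_Diff[OF finite_verts]] using \<epsilon>(1) by (auto simp: pspan_uminus)
qed (simp add: pspan_0)

lemma chain_cycle: "chain (pspan (cover_exps k)) (length ps) (cycle ps)"
  using chain_cross_cycle[OF verts_V monom_b_mem] cycle_mem by (simp add: chain_def)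

lemma bd_cycle: "bd (cycle ps) \<sigma> = 0"
proof (cases "\<sigma> \<subseteq> A \<union> B")
  case True
  then show ?thesis using bd_cross_cycle[OF verts_V] finite_subset[OF True finite_V] by blast
next
  case False
  then show ?thesis using chain_bd_outside[OF chain_cycle] by blast
qed

text \<open>In the multidegree of the cycle, the ideal has no chains of the next degree; it suffices to
  compare one coefficient.\<close>

lemma cycle_not_boundary:
  assumes w: "chain (pspan (cover_exps k)) j w"
  shows "cycle ps (snd ` set ps) \<noteq> bd w (snd ` set ps)"
proof
  let ?\<sigma> = "snd ` set ps" and ?P = "fst ` set ps"
  \<comment> \<open>The exponent of the coefficient at the facet of all second entries:
    \<open>b\<close> raised by \<open>Suc k\<close> at every first entry.\<close>
  let ?t = "(\<Sum>v\<in>?P. Poly_Mapping.single v (Suc k)) + Abs_poly_mapping b"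
  assume eq: "cycle ps ?\<sigma> = bd w ?\<sigma>"
  have t: "expo ?t i = (if i \<in> ?P then Suc k else 0) + b i" for i
    using expo_sum_single[of ?P "Suc k" i] by (simp add: lookup_add expo_b)
  obtain \<epsilon> where \<epsilon>: "\<epsilon> \<in> {1, -1}" "cycle ps ?\<sigma> = \<epsilon> * ((\<Prod>v\<in>?P. var_power (Suc k) v) * monom b)"
    using cross_cycle_facet[OF ordered_matching_distinct[OF om], of "monom b"] by blast
  have "Poly_Mapping.lookup (cycle ps ?\<sigma>) ?t \<noteq> 0"
    unfolding \<epsilon>(2) prod_monom_b[OF finite_imageI[OF finite_set]] using \<epsilon>(1) by auto
  moreover have "Poly_Mapping.lookup (bd w ?\<sigma>) ?t = 0"
    unfolding bd_def lookup_sum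
  proof (intro sum.neutral ballI)
    fix i assume i: "i \<in> A \<union> B - ?\<sigma>"
    let ?w = "w (insert i ?\<sigma>)"
    have "Poly_Mapping.lookup (?w * var_power (Suc k) i) ?t = 0"
    proof (cases "i \<in> ?P")
      case True
      \<comment> \<open>After division by the power of \<open>i\<close>, both ends of its matching
        edge are back at their values in \<open>b\<close>, with sum below \<open>k\<close>: the
        quotient is not in the ideal.\<close>
      then obtain q where q: "(i, q) \<in> set ps" by auto
      let ?r = "?t - Poly_Mapping.single i (Suc k)"
      have tr: "?r + Poly_Mapping.single i (Suc k) = ?t"
        using True t by (intro poly_mapping_eqI) (auto simp: lookup_add lookup_minus lookup_single when_def)
      have mem: "i \<in> A" "q \<in> B" "adj i q" using ordered_matching_mem[OF om q] by auto
      have "q \<notin> ?P"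
        using ordered_matching_mem[OF om] mem(2) disj by force
      then have "expo ?r q = b q" "expo ?r i = b i"
        using True mem disj t by (auto simp: lookup_minus lookup_single when_def)
      then have "expo ?r i + expo ?r q < k"
        using base_exps_matched[OF om len q] by (simp add: b_def)
      then have "expo ?r \<notin> cover_exps k" using mem by (auto simp: cover_exps_def covers_def not_le)
      then have "Poly_Mapping.lookup ?w ?r = 0" using w by (intro pspan_lookup) (auto simp: chain_def)
      then show ?thesis using lookup_mult_single[of ?w "Poly_Mapping.single i (Suc k)" ?r] unfolding tr by simp
    next
      case False
      \<comment> \<open>An unmatched vertex has exponent \<open>k\<close> only, so its power does
        not divide the monomial.\<close>
      then have tk: "expo ?t i = k" using t i base_exps_unmatched[of i ps k] by (auto simp: b_def)
      have "?t \<noteq> r + Poly_Mapping.single i (Suc k)" for r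
      proof
        assume eq: "?t = r + Poly_Mapping.single i (Suc k)"
        show False using tk unfolding eq by (simp add: lookup_add)
      qed
      then show ?thesis by (rule lookup_mult_single_0)
    qed
    moreover have "koszul_sign i ?\<sigma> \<in> {1, -1 :: ('v, 'k) mpoly}" by (rule koszul_sign_cases)
    ultimately show "Poly_Mapping.lookup (koszul_sign i ?\<sigma> * var_power (Suc k) i * ?w) ?t = 0"
      by (auto simp: mult.commute)
  qed
  ultimately show False using eq by simp
qed

lemma koszul_class_ideal:
  "koszul_class (pspan (cover_exps k)) (pspan {}) (length ps) (cycle ps)"
proof -
  have zero: "p = 0" if "p \<in> pspan {}" for p :: "('v, 'k) mpoly"
    using pspan_disjoint[of "{}" "{}" p] that by simp
  have "\<not> boundary (pspan (cover_exps k)) (pspan {}) (length ps) (cycle ps)"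
  proof
    assume "boundary (pspan (cover_exps k)) (pspan {}) (length ps) (cycle ps)"
    then obtain w where "chain (pspan (cover_exps k)) (Suc (length ps)) w" "\<And>\<sigma>. cycle ps \<sigma> = bd w \<sigma>"
      unfolding boundary_def using zero by (metis eq_iff_diff_eq_0)
    then show False using cycle_not_boundary by blast
  qed
  then show ?thesis using chain_cycle by (simp add: koszul_class_def bd_cycle pspan_0)
qed

text \<open>The boundary of this chain is the cycle in J^k. If the chain were itself a boundary
  modulo J^k, the cycle would bound within J^k.\<close>

lemma koszul_class_quotient:
  assumes "ps = e # ps'"
  shows "koszul_class (pspan (supported (A \<union> B))) (pspan (cover_exps k)) (Suc (length ps))
    (wedge (fst e) (wedge (snd e) (cycle ps')))" (is "koszul_class _ _ _ ?z")
proof -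
  have R: "submod (pspan (supported (A \<union> B)) :: ('v, 'k) mpoly set)"
    by (simp add: submod_def zero_R add_R mult_R)
  have V: "verts ps' \<subseteq> A \<union> B" "fst e \<in> A \<union> B" "snd e \<in> A \<union> B"
    using verts_V by (auto simp: assms verts_Cons)
  have z: "chain (pspan (supported (A \<union> B))) (Suc (length ps)) ?z"
    using chain_wedge[OF R chain_wedge[OF R chain_cross_cycle[OF V(1) monom_b_mem] V(3)] V(2)]
    by (simp only: length_Cons arg_cong[OF assms, of length])
  have bd_z: "bd ?z \<sigma> = cycle ps \<sigma>" if "finite \<sigma>" for \<sigma>
    using bd_wedge_wedge_cross_cycle[OF verts_V[unfolded assms] that] unfolding assms[symmetric] .
  have "bd ?z \<sigma> \<in> pspan (cover_exps k)" for \<sigma>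
  proof (cases "\<sigma> \<subseteq> A \<union> B")
    case True
    then show ?thesis using bd_z finite_subset[OF True finite_V] cycle_mem by simp
  next
    case False
    then have "bd ?z \<sigma> = 0" using chain_bd_outside[OF z] by blast
    then show ?thesis by (simp add: pspan_0)
  qed
  moreover have "\<not> boundary (pspan (supported (A \<union> B))) (pspan (cover_exps k)) (Suc (length ps)) ?z"
  proof
    assume "boundary (pspan (supported (A \<union> B))) (pspan (cover_exps k)) (Suc (length ps)) ?z"
    then obtain v where v: "chain (pspan (supported (A \<union> B))) (Suc (Suc (length ps))) v"
      "\<And>\<sigma>. ?z \<sigma> - bd v \<sigma> \<in> pspan (cover_exps k)"
      unfolding boundary_def by blast
    \<comment> \<open>Subtracting \<open>bd v\<close> moves the chain into the ideal without
      changing its boundary.\<close>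
    define u where "u = (\<lambda>\<sigma>. ?z \<sigma> - bd v \<sigma>)"
    have "u \<sigma> = 0" if "\<not> (\<sigma> \<subseteq> A \<union> B \<and> card \<sigma> = Suc (length ps))" for \<sigma>
      using chain_outside[OF z that] chain_bd_outside[OF v(1), of \<sigma>] that by (auto simp: u_def)
    then have "chain (pspan (cover_exps k)) (Suc (length ps)) u"
      using v(2) by (auto simp: chain_def u_def)
    moreover have "bd u (snd ` set ps) = cycle ps (snd ` set ps)"
      by (simp add: u_def bd_diff bd_bd bd_z)
    ultimately show False using cycle_not_boundary by metis
  qed
  ultimately show ?thesis using z by (simp add: koszul_class_def)
qed

end

section \<open>Powers of cover ideals\<close>

lemma ideal_presentation:
  assumes V: "finite V" and X: "upward_closed V X"
  shows "monomial_presentation V X {}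
    (ideal_module (mpoly_ring V) (pspan X :: ('v::linorder, 'k::field) mpoly set)) (\<lambda>p. p)"
proof (rule monomial_presentation.intro)
  show "abelian_monoid (ideal_module (mpoly_ring V) (pspan X :: ('v, 'k) mpoly set))"
    by (rule abelian_monoidI) (auto simp: ideal_module_def pspan_add pspan_0 algebra_simps)
  show "p = \<zero>\<^bsub>ideal_module (mpoly_ring V) (pspan X)\<^esub> \<longleftrightarrow> p \<in> pspan {}" for p :: "('v, 'k) mpoly"
    using pspan_disjoint[of "{}" "{}" p] pspan_0 by (auto simp: ideal_module_def)
qed (use V X in \<open>auto simp: ideal_module_def upward_closed_def\<close>)

lemma quotient_presentation:
  assumes V: "finite V" and X: "upward_closed V X"
  shows "monomial_presentation V (supported V) X
    (quotient_module (mpoly_ring V) (pspan X :: ('v::linorder, 'k::field) mpoly set))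
    (\<lambda>p. pspan X +>\<^bsub>mpoly_ring V\<^esub> p)"
proof -
  let ?S = "mpoly_ring V :: ('v, 'k) mpoly ring" and ?I = "pspan X :: ('v, 'k) mpoly set"
  let ?M = "quotient_module ?S ?I"
  interpret ideal ?I ?S by (rule ideal_pspan[OF X])
  interpret Q: ring "?S Quot ?I" by (rule quotient_is_ring)
  have M: "carrier ?M = carrier (?S Quot ?I)" "zero ?M = zero (?S Quot ?I)" "add ?M = add (?S Quot ?I)"
    by (simp_all add: quotient_module_def)
  have carr: "carrier (?S Quot ?I) = (\<lambda>p. ?I +>\<^bsub>?S\<^esub> p) ` pspan (supported V)"
    by (auto simp: FactRing_def A_RCOSETS_def' carrier_mpoly_ring)
  have hom: "(\<lambda>p. ?I +>\<^bsub>?S\<^esub> p) \<in> ring_hom ?S (?S Quot ?I)" by (rule rcos_ring_hom)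
  show ?thesis
  proof (rule monomial_presentation.intro)
    show "abelian_monoid ?M"
      by (rule abelian_monoidI) (simp_all only: M Q.add.m_closed Q.zero_closed Q.a_assoc Q.l_zero, rule Q.add.m_comm)
    show "carrier ?M = (\<lambda>p. ?I +>\<^bsub>?S\<^esub> p) ` pspan (supported V)" by (simp add: M carr)
    fix p q :: "('v, 'k) mpoly" assume pq: "p \<in> pspan (supported V)" "q \<in> pspan (supported V)"
    then show "?I +>\<^bsub>?S\<^esub> (p + q) = (?I +>\<^bsub>?S\<^esub> p) \<oplus>\<^bsub>?M\<^esub> (?I +>\<^bsub>?S\<^esub> q)"
      using ring_hom_add[OF hom, of p q] by (simp add: M carrier_mpoly_ring)
    show "?I +>\<^bsub>?S\<^esub> (p * q) = p \<odot>\<^bsub>?M\<^esub> (?I +>\<^bsub>?S\<^esub> q)"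
      using ring_hom_mult[OF hom, of p q] pq by (simp add: quotient_module_def carrier_mpoly_ring)
    show "?I +>\<^bsub>?S\<^esub> p = \<zero>\<^bsub>?M\<^esub> \<longleftrightarrow> p \<in> ?I"
      using rcos_const_imp_mem[of p] a_rcos_const[of p] pq
      by (auto simp: M FactRing_def carrier_mpoly_ring)
  qed (use V X in \<open>auto simp: upward_closed_def intro: supported_add\<close>)
qed

lemma monom_component:
  assumes "finite V" "u \<in> supported V"
  shows "(monom u :: ('v, 'k::field) mpoly) \<in> mpoly_component V (\<lambda>i. int (u i))"
  using expo_Abs[OF assms] assms(2)
  by (simp add: mpoly_component_def monom_def carrier_mpoly_ring pspan_single)

theorem corollary3p4:
  fixes n :: nat and E :: "nat set set"
    and S :: "(nat, 'k::field) mpoly ring"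
    and J \<mm> :: "(nat, 'k) mpoly set"
  assumes "simple_graph {1..n} E" and "bipartite {1..n} E"
    and "S = mpoly_ring {1..n}"
    and "\<mm> = max_homogeneous_ideal {1..n}"
    and "J = cover_ideal {1..n} E"
  shows "\<exists>n\<^sub>0\<ge>1. \<forall>k::nat. k \<ge> n\<^sub>0 \<longrightarrow>
    (let I = J [^]\<^bsub>ideals_set S\<^esub> k in
      depth \<mm> (ideal_module S I)
        \<le> sdepth {1..n} (ideal_component {1..n} I) (ideal_module S I) \<and>
      depth \<mm> (quotient_module S I)
        \<le> sdepth {1..n} (quotient_component {1..n} I) (quotient_module S I))"
proof -
  obtain A B where AB: "A \<union> B = {1..n}" "A \<inter> B = {}"
    and E: "\<And>e. e \<in> E \<Longrightarrow> \<exists>a\<in>A. \<exists>b\<in>B. e = {a, b}"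
    using assms(2) unfolding bipartite_def by metis
  define adj where "adj = (\<lambda>a b. {a, b} \<in> E)"
  have finV: "finite (A \<union> B)" by (simp add: AB)
  interpret bipartition A B adj
    using finV AB(2) by (intro bipartition.intro) simp_all
  have bounded: "\<forall>ps. ordered_matching ps \<longrightarrow> length ps < Suc (card A)"
    using ordered_matching_length by (simp add: less_Suc_eq_le)
  have "ordered_matching []" by simp
  from ex_has_greatest_nat[OF this bounded] obtain ps where om: "ordered_matching ps"
    and max: "\<And>qs. ordered_matching qs \<Longrightarrow> length qs \<le> length ps"
    by blast
  let ?V = "A \<union> B" and ?s = "length ps"
  have main: "depth \<mm> (ideal_module S I) \<le> sdepth ?V (ideal_component ?V I) (ideal_module S I) \<and>
      depth \<mm> (quotient_module S I) \<le> sdepth ?V (quotient_component ?V I) (quotient_module S I)"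
    if k: "?s \<le> k" and I: "I = J [^]\<^bsub>ideals_set S\<^esub> k" for k I
  proof -
    have S: "S = mpoly_ring ?V" and \<mm>: "\<mm> = max_homogeneous_ideal ?V" using assms AB by simp_all
    have J: "J = pspan (cover_exps 1)"
      unfolding assms(5) AB(1)[symmetric] by (rule cover_ideal_eq[OF E]) (simp_all add: adj_def)
    have I: "I = pspan (cover_exps k)"
      unfolding I S J by (rule pspan_cover_exps_power)
    interpret matched_bipartition A B adj ps k "TYPE('k)"
      using om k by unfold_locales
    note up = upward_closed_cover_exps[of k]
    interpret MI: monomial_presentation ?V "cover_exps k" "{}" "ideal_module S I" "\<lambda>p. p"
      unfolding I S by (rule ideal_presentation[OF finV up])
    interpret MQ: monomial_presentation ?V "supported ?V" "cover_exps k" "quotient_module S I"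
      "\<lambda>p. I +>\<^bsub>S\<^esub> p"
      unfolding I S by (rule quotient_presentation[OF finV up])
    have box: "box (\<lambda>_. 0) ?V = supported ?V" by (auto simp: box_def supported_def)
    \<comment> \<open>The start of the splitting: base zero, all coordinates free and
      \<open>B' = B\<close>, so that no edge counts as settled; the matching bound is maximality of
      \<open>ps\<close>.\<close>
    have boxes: "box_union ?V (card ?V - ?s) (box (\<lambda>_. 0) ?V \<inter> covers k) \<and>
        box_union ?V (card ?V - Suc ?s) (box (\<lambda>_. 0) ?V - covers k)"
      using max by (intro box_union_covers[of B]) auto
    have boxI: "box_union ?V (card ?V - ?s) (cover_exps k - {})"
      and boxQ: "box_union ?V (card ?V - Suc ?s) (supported ?V - cover_exps k)"
    proof -
      have "box (\<lambda>_. 0) ?V \<inter> covers k = cover_exps k - {}"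
        "box (\<lambda>_. 0) ?V - covers k = supported ?V - cover_exps k"
        by (auto simp: box cover_exps_def)
      then show "box_union ?V (card ?V - ?s) (cover_exps k - {})"
        "box_union ?V (card ?V - Suc ?s) (supported ?V - cover_exps k)"
        using boxes by simp_all
    qed
    have grI: "\<exists>a. (monom u :: (nat, 'k) mpoly) \<in> ideal_component ?V I a" if "u \<in> cover_exps k - {}" for u
    proof -
      have u: "u \<in> supported ?V" using that by (simp add: cover_exps_def)
      then have "(monom u :: (nat, 'k) mpoly) \<in> I"
        using that expo_Abs[OF finV u] by (simp add: I monom_def pspan_single)
      then show ?thesis using monom_component[OF finV u] by (auto simp: ideal_component_def)
    qed
    have grQ: "\<exists>a. I +>\<^bsub>S\<^esub> (monom u :: (nat, 'k) mpoly) \<in> quotient_component ?V I a"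
      if "u \<in> supported ?V - cover_exps k" for u
      using monom_component[OF finV] that by (auto simp: quotient_component_def S)
    have "depth \<mm> (ideal_module S I) \<le> enat (card ?V - ?s)"
      unfolding \<mm> by (rule MI.depth_le[OF koszul_class_ideal])
    also have "enat (card ?V - ?s) \<le> sdepth ?V (ideal_component ?V I) (ideal_module S I)"
      by (rule MI.sdepth_ge[OF boxI grI])
    finally have ideal: "depth \<mm> (ideal_module S I) \<le> sdepth ?V (ideal_component ?V I) (ideal_module S I)" .
    have "depth \<mm> (quotient_module S I) \<le> sdepth ?V (quotient_component ?V I) (quotient_module S I)"
    proof (cases ps)
      case Nil
      have "\<not> adj a w" if "a \<in> A" "w \<in> B" for a w
        using max[of "[(a, w)]"] that Nil by auto
      \<comment> \<open>Without edges the quotient is zero. The empty partition then serves every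
        dimension \<open>d\<close>, which makes the Stanley depth infinite.\<close>
      then have empty: "supported ?V - cover_exps k = {}"
        by (auto simp: cover_exps_def covers_def)
      have "enat d \<le> sdepth ?V (quotient_component ?V I) (quotient_module S I)" for d
        by (rule MQ.sdepth_ge) (use grQ in \<open>simp_all only: empty box_union.empty\<close>)
      then have "sdepth ?V (quotient_component ?V I) (quotient_module S I) = \<infinity>"
        by (metis enat_ord_simps(1) not_enat_eq not_less_eq_eq order_refl)
      then show ?thesis by simp
    next
      case (Cons e ps')
      have "depth \<mm> (quotient_module S I) \<le> enat (card ?V - Suc ?s)"
        unfolding \<mm> by (rule MQ.depth_le[OF koszul_class_quotient[OF Cons]])
      also have "enat (card ?V - Suc ?s) \<le> sdepth ?V (quotient_component ?V I) (quotient_module S I)"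
        by (rule MQ.sdepth_ge[OF boxQ grQ])
      finally show ?thesis .
    qed
    with ideal show ?thesis by blast
  qed
  show ?thesis
    unfolding AB(1)[symmetric] Let_def
    \<comment> \<open>Only \<open>k \<ge> s\<close> matters for the argument; the maximum with 1
      meets the requirement on the threshold.\<close>
    by (rule exI[of _ "max 1 ?s"]) (use main in auto)
qed

end
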